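(* Let $F$ be a necklace with a NIFS $\{f_1,\dots,f_n\}$ on $\mathbb{R}^d$ and ordered main nodes $z_1,\dots,z_n$ (with $z_0=z_n$), and let $I=\{1,\dots,n\}$. If $F$ has no cut points, then $N_2(F)=n-2$ and $\{z_{k-1},z_k\}$, $k\in I$, are extremal $2$-cuts of $F$. Moreover, if $F$ is good, then $\{z_{k-1},z_k\}$, $k\in I$, are the only extremal $2$-cuts of $F$.
   Context: A map $f:\mathbb{R}^d\to\mathbb{R}^d$ is contracting if there is $0<c<1$ with $|f(x)-f(y)|\le c|x-y|$ for all $x,y\in\mathbb{R}^d$. The attractor of a finite family $\{f_1,\dots,f_n\}$ of contracting maps of $\mathbb{R}^d$ is the unique nonempty compact $F\subset\mathbb{R}^d$ with $F=\bigcup_{k=1}^n f_k(F)$. An ordered family $\{f_1,\dots,f_n\}$ is a necklace iterated function system (NIFS), and its attractor $F$ is a (fractal) necklace, if $n\ge 3$, $f_1,\dots,f_n$ are contracting homeomorphisms of $\mathbb{R}^d$, and for all distinct $m,k\in I:=\{1,\dots,n\}$ the set $f_m(F)\cap f_k(F)$ is a singleton if $|m-k|=1$ or $|m-k|=n-1$, and is empty if $2\le|m-k|\le n-2$. Write $F_{i_1\cdots i_m}=f_{i_1}\circ\cdots\circ f_{i_m}(F)$ for $i_1\cdots i_m\in I^m$. The main nodes $z_1,\dots,z_n$ are defined by $F_k\cap F_{k+1}=\{z_k\}$, with the conventions $F_{n+1}=F_1$, $z_0=z_n$. The main nodes of a NIFS are understood to be pairwise distinct (this is automatic for $n\ge4$),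 so that $\partial_F F_k=\{z_{k-1},z_k\}$ consists of two points for each $k\in I$, where $\partial_F$ denotes boundary in the relative topology of $F$. $F$ (with its NIFS) is good if $\sharp(F_{kj}\cap\partial_F F_k)\le 1$ for all $k,j\in I$, where $\sharp$ denotes cardinality. Necklaces are connected and locally connected. For a connected topological space $X$, a subset $A\subset X$ is a cut of $X$ if $X\setminus A$ is not connected and $X\setminus B$ is connected for each $B\subsetneq A$. A cut consisting of $k$ points is a $k$-cut; a $1$-cut is also called a cut point. For $A\subset X$ put $N(A,X)=\sup\{\mathrm{ncp}(\overline{C}): C\text{ is a component of }X\setminus A\}$, where a component is a maximal connected subset, $\overline{C}$ is the closure of $C$ in $X$, and $\mathrm{ncp}(\overline{C})$ is the number of cut points of $\overline{C}$. For $k\ge1$ put $N_k(X)=\sup\{N(A,X): A\text{ is a }k\text{-cut of }X\}$. A $k$-cut $A$ of $X$ is extremal if $N(A,X)=N_k(X)$. *)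

theory Defs
  imports "HOL-Analysis.Analysis"
begin

section \<open>Cuts of topological spaces\<close>

text \<open>Cardinality with infinite sets counted as \<open>\<infinity>\<close>, where \<^const>\<open>card\<close> would give \<open>0\<close>.\<close>
definition ecard :: "'a set \<Rightarrow> enat" where
  "ecard S = (if finite S then enat (card S) else \<infinity>)"

definition is_cut :: "'a topology \<Rightarrow> 'a set \<Rightarrow> bool" where
  "is_cut X A \<longleftrightarrow>
     connected_space X \<and> A \<subseteq> topspace X \<and>
     \<not> connected_space (subtopology X (topspace X - A)) \<and>
     (\<forall>B. B \<subset> A \<longrightarrow> connected_space (subtopology X (topspace X - B)))"

definition is_k_cut :: "nat \<Rightarrow> 'a topology \<Rightarrow> 'a set \<Rightarrow> bool" where
  "is_k_cut k X A \<longleftrightarrow> is_cut X A \<and> ecard A = enat k"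

definition cut_points :: "'a topology \<Rightarrow> 'a set" where
  "cut_points X = {x. is_k_cut 1 X {x}}"

definition ncp :: "'a topology \<Rightarrow> enat" where
  "ncp X = ecard (cut_points X)"

text \<open>The supremum is taken in \<^typ>\<open>enat\<close>, so it always exists; over an empty family it is \<open>0\<close>.\<close>
definition cut_N :: "'a set \<Rightarrow> 'a topology \<Rightarrow> enat" where
  "cut_N A X =
     (SUP C \<in> connected_components_of (subtopology X (topspace X - A)).
        ncp (subtopology X (X closure_of C)))"

definition cut_N_k :: "nat \<Rightarrow> 'a topology \<Rightarrow> enat" where
  "cut_N_k k X = (SUP A \<in> {A. is_k_cut k X A}. cut_N A X)"

definition extremal_k_cut :: "nat \<Rightarrow> 'a topology \<Rightarrow> 'a set \<Rightarrow> bool" where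
  "extremal_k_cut k X A \<longleftrightarrow> is_k_cut k X A \<and> cut_N A X = cut_N_k k X"

section \<open>Necklaces\<close>

definition contracting :: "('a::metric_space \<Rightarrow> 'a) \<Rightarrow> bool" where
  "contracting f \<longleftrightarrow> (\<exists>c. 0 < c \<and> c < 1 \<and> (\<forall>x y. dist (f x) (f y) \<le> c * dist x y))"

text \<open>Families \<open>f\<^sub>1, \<dots>, f\<^sub>n\<close> are functions on \<^typ>\<open>nat\<close> of which only the values at
  \<open>1, \<dots>, n\<close> matter. For contracting maps of a complete space the predicate below determines
  \<open>F\<close> uniquely.\<close>
definition is_attractor :: "nat \<Rightarrow> (nat \<Rightarrow> 'a::metric_space \<Rightarrow> 'a) \<Rightarrow> 'a set \<Rightarrow> bool" where
  "is_attractor n f F \<longleftrightarrow> F \<noteq> {} \<and> compact F \<and> F = (\<Union>k\<in>{1..n}. f k ` F)"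

text \<open>\<open>f\<^sub>1, \<dots>, f\<^sub>n\<close> is a NIFS with attractor \<open>F\<close>.\<close>
definition is_NIFS :: "nat \<Rightarrow> (nat \<Rightarrow> 'a::metric_space \<Rightarrow> 'a) \<Rightarrow> 'a set \<Rightarrow> bool" where
  "is_NIFS n f F \<longleftrightarrow>
     3 \<le> n \<and>
     (\<forall>k\<in>{1..n}. contracting (f k) \<and> (\<exists>g. homeomorphism UNIV UNIV (f k) g)) \<and>
     is_attractor n f F \<and>
     (\<forall>m\<in>{1..n}. \<forall>k\<in>{1..n}. m \<noteq> k \<longrightarrow>
        (\<bar>int m - int k\<bar> = 1 \<or> \<bar>int m - int k\<bar> = int n - 1
           \<longrightarrow> is_singleton (f m ` F \<inter> f k ` F)) \<and>
        (2 \<le> \<bar>int m - int k\<bar> \<and> \<bar>int m - int k\<bar> \<le> int n - 2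
           \<longrightarrow> f m ` F \<inter> f k ` F = {}))"

text \<open>\<open>z\<^sub>1, \<dots>, z\<^sub>n\<close> are the main nodes, with \<open>z\<^sub>0 = z\<^sub>n\<close>; the index \<open>k mod n + 1\<close> is the cyclic
  successor of \<open>k\<close> in \<open>1, \<dots>, n\<close>. Main nodes are understood to be pairwise distinct, which is a
  genuine condition only for \<open>n = 3\<close>.\<close>
definition main_nodes ::
  "nat \<Rightarrow> (nat \<Rightarrow> 'a::metric_space \<Rightarrow> 'a) \<Rightarrow> 'a set \<Rightarrow> (nat \<Rightarrow> 'a) \<Rightarrow> bool" where
  "main_nodes n f F z \<longleftrightarrow>
     (\<forall>k\<in>{1..n}. f k ` F \<inter> f (k mod n + 1) ` F = {z k}) \<and> z 0 = z n \<and> inj_on z {1..n}"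

definition good_necklace :: "nat \<Rightarrow> (nat \<Rightarrow> 'a::metric_space \<Rightarrow> 'a) \<Rightarrow> 'a set \<Rightarrow> bool" where
  "good_necklace n f F \<longleftrightarrow>
     (\<forall>k\<in>{1..n}. \<forall>j\<in>{1..n}.
        ecard ((f k \<circ> f j) ` F \<inter> (top_of_set F frontier_of (f k ` F))) \<le> 1)"

end

theory Submission
  imports Defs
begin

text \<open>
  Call the sets \<open>f\<^sub>k(F)\<close> beads. They form a ring, neighbouring beads meeting in a main node, and each bead is a
  copy of \<open>F\<close>; so \<open>F\<close> and its beads are connected, locally connected and without cut points.

  Removing two adjacent nodes \<open>z\<^sub>k\<^sub>-\<^sub>1\<close>, \<open>z\<^sub>k\<close> leaves one component whose closure is the chain of the other
  \<open>n - 1\<close> beads. The cut points of a chain of beads are its inner nodes (\<open>cutset_chain\<close>), here \<open>n - 2\<close> of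
  them. Everything else is the upper bound: for all \<open>a \<noteq> b\<close> in \<open>F\<close>, the closure of a component \<open>C\<close> of
  \<open>F - {a, b}\<close> has at most \<open>n - 2\<close> cut points, and for a good necklace equality holds only in the case just
  described (\<open>bounded_cutset_component\<close>).

  If no bead contains both points, the remainder is connected, or \<open>a\<close> and \<open>b\<close> are non-adjacent nodes and
  there are two chains of at most \<open>n - 2\<close> beads; both cases give fewer than \<open>n - 2\<close> cut points. If a bead
  \<open>B\<close> contains both, a component inside \<open>B\<close> that avoids the other beads is a copy of a component for the
  pair pulled back to \<open>F\<close>, whose distance is larger by a fixed factor; so one argues by induction. The other
  component, unless \<open>a\<close> and \<open>b\<close> are the nodes of \<open>B\<close>, consists of the remaining beads, an ear \<open>R\<close> attached at
  the two nodes of \<open>B\<close>, and of the components of \<open>B - {a, b}\<close> that contain a node of \<open>B\<close>. An ear adds no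
  cut points (\<open>cutset_ear\<close>). Two components of \<open>B - {a, b}\<close> form a loop without cut points
  (\<open>cutset_two_components\<close>); a single one is again controlled by the induction hypothesis.

  Goodness enters through the observation that equality for the pulled-back pair yields the image in \<open>B\<close> of
  all beads but one. A component avoiding both nodes of \<open>B\<close> would then force these into the image of the
  missing bead, which goodness excludes. If the component contains or touches both nodes, they lie in
  different beads of the image chain, so some cut point of this chain separates them, and it is no longer a
  cut point after the ear is attached (\<open>not_cutset_ear\<close>).
\<close>

section \<open>Cut points of subsets\<close>

text \<open>For connected \<open>X\<close> this is the set of cut points of \<open>X\<close>. Phrasing it through \<^const>\<open>connected\<close>
  instead of subtopologies lets all the work be done with subsets of one fixed space.\<close>
definition cutset :: "'a::topological_space set \<Rightarrow> 'a set" where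
  "cutset X = {p \<in> X. \<not> connected (X - {p})}"

lemma connected_space_top_of_set [simp]: "connected_space (top_of_set S) \<longleftrightarrow> connected S"
  by (metis connectedin_def connectedin_iff_connected subset_UNIV topspace_euclidean)

lemma cut_points_top_of_set:
  assumes "connected X"
  shows "cut_points (top_of_set X) = cutset X"
proof -
  have "is_cut (top_of_set X) {x} \<longleftrightarrow> x \<in> cutset X" for x
    using assms
    by (auto simp: is_cut_def cutset_def subtopology_subtopology Int_absorb1 subset_singleton_iff psubset_eq)
  then show ?thesis
    by (auto simp: cut_points_def is_k_cut_def ecard_def one_enat_def)
qed

text \<open>When single points never disconnect \<open>X\<close>, the minimality clause in the definition of a cut holds
  for every pair of points.\<close>
lemma is_2_cut_top_of_set:
  assumes "connected X" "cutset X = {}"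
  shows "is_k_cut 2 (top_of_set X) A \<longleftrightarrow>
    (\<exists>a b. A = {a, b} \<and> a \<noteq> b \<and> a \<in> X \<and> b \<in> X \<and> \<not> connected (X - A))"
    (is "?L \<longleftrightarrow> ?R")
proof
  assume L: ?L
  then have "card A = 2" "A \<subseteq> X" "\<not> connected (X - A)"
    by (auto simp: is_k_cut_def is_cut_def ecard_def subtopology_subtopology Int_absorb1 Diff_subset
      split: if_splits)
  then show ?R by (metis card_2_iff insert_subset)
next
  assume ?R
  then obtain a b where ab: "A = {a, b}" "a \<noteq> b" "a \<in> X" "b \<in> X" "\<not> connected (X - A)" by blast
  have con1: "connected (X - {p})" for p
    using assms by (cases "p \<in> X") (auto simp: cutset_def)
  have "connected (X - B)" if "B \<subset> A" for B
  proof -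
    have "B = {} \<or> B = {a} \<or> B = {b}" using that ab(1) by blast
    then show ?thesis using assms(1) con1 by auto
  qed
  then show ?L using ab assms(1)
    by (auto simp: is_k_cut_def is_cut_def ecard_def subtopology_subtopology Int_absorb1 Diff_subset)
qed

lemma connected_components_of_top_of_set:
  "connected_components_of (top_of_set S) = components S"
proof -
  have "connected_component_of_set (top_of_set S) x = connected_component_set S x" for x
    by (auto simp: connected_component_of_def connected_component_def connectedin_subtopology)
  then show ?thesis
    by (auto simp: connected_components_of_def components_def)
qed

lemma cut_N_top_of_set:
  assumes "closed X" "A \<subseteq> X"
  shows "cut_N A (top_of_set X) = (SUP C \<in> components (X - A). ecard (cutset (closure C)))"
proof -
  have "ncp (subtopology (top_of_set X) (top_of_set X closure_of C)) = ecard (cutset (closure C))"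
    if "C \<in> components (X - A)" for C
  proof -
    have "C \<subseteq> X" "connected C" using that in_components_subset in_components_connected by blast+
    then have "top_of_set X closure_of C = closure C"
      using assms(1) by (simp add: closure_of_subtopology Int_absorb1 closure_minimal)
    moreover have "connected (closure C)" using \<open>connected C\<close> by (rule connected_imp_connected_closure)
    ultimately show ?thesis
      using \<open>C \<subseteq> X\<close> assms(1)
      by (simp add: ncp_def subtopology_subtopology closure_minimal Int_absorb1 cut_points_top_of_set)
  qed
  then show ?thesis
    by (simp add: cut_N_def subtopology_subtopology Diff_subset Int_absorb1 connected_components_of_top_of_set)
qed

section \<open>Transport along homeomorphisms\<close>

lemma homeomorphism_connected_image:
  assumes "homeomorphism UNIV UNIV f g"
  shows "connected (f ` S) \<longleftrightarrow> connected S"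
proof -
  have "continuous_on S f" "continuous_on (f ` S) g" "g ` f ` S = S"
    using assms by (auto simp: homeomorphism_def image_image intro: continuous_on_subset)
  then show ?thesis by (metis connected_continuous_image)
qed

lemma homeomorphism_closure_image:
  assumes "homeomorphism UNIV UNIV f g"
  shows "closure (f ` S) = f ` closure S"
proof -
  have "f ` closure S = g -` closure S"
    using assms by (force simp: homeomorphism_def)
  moreover have "closed (g -` closure S)"
    using assms by (intro closed_vimage) (auto simp: homeomorphism_def)
  ultimately have "closure (f ` S) \<subseteq> f ` closure S"
    by (metis closure_minimal closure_subset image_mono)
  moreover have "f ` closure S \<subseteq> closure (f ` S)"
    using assms by (intro image_closure_subset closed_closure closure_subset)
      (auto simp: homeomorphism_def intro: continuous_on_subset)
  ultimately show ?thesis by blast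
qed

lemma homeomorphism_inj: "homeomorphism UNIV UNIV f g \<Longrightarrow> inj f"
  by (metis homeomorphism_apply1 inj_on_def iso_tuple_UNIV_I)

lemma cutset_image:
  assumes "homeomorphism UNIV UNIV f g"
  shows "cutset (f ` X) = f ` cutset X"
proof -
  have "f ` X - {f p} = f ` (X - {p})" for p
    using homeomorphism_inj[OF assms] by (auto simp: inj_def)
  then show ?thesis
    using homeomorphism_connected_image[OF assms] by (auto simp: cutset_def)
qed

lemma component_image:
  assumes "homeomorphism UNIV UNIV f g" "C \<in> components B"
  shows "f ` C \<in> components (f ` B)"
proof -
  have gf: "g ` f ` E = E" "f ` g ` E' = E'" for E E'
    using assms(1) by (auto simp: homeomorphism_def image_image)
  have hg: "homeomorphism UNIV UNIV g f" using assms(1) by (simp add: homeomorphism_symD)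
  have C: "C \<noteq> {}" "C \<subseteq> B" "connected C"
    "\<And>E. E \<noteq> {} \<Longrightarrow> C \<subseteq> E \<Longrightarrow> E \<subseteq> B \<Longrightarrow> connected E \<Longrightarrow> E = C"
    using assms(2) by (auto simp: in_components_maximal)
  show ?thesis unfolding in_components_maximal
  proof (intro conjI allI impI)
    fix E assume E: "E \<noteq> {} \<and> f ` C \<subseteq> E \<and> E \<subseteq> f ` B \<and> connected E"
    have "g ` E = C"
      using E gf(1) C(1) homeomorphism_connected_image[OF hg] image_mono[of "f ` C" E g] image_mono[of E "f ` B" g]
      by (intro C(4)) auto
    then show "E = f ` C" using gf(2) by metis
  qed (use C homeomorphism_connected_image[OF assms(1)] in auto)
qed

lemma components_image:
  assumes "homeomorphism UNIV UNIV f g"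
  shows "components (f ` S) = (`) f ` components S"
proof (intro subset_antisym subsetI)
  fix C assume "C \<in> components (f ` S)"
  then have "g ` C \<in> components (g ` f ` S)"
    by (rule component_image[OF homeomorphism_symD[OF assms]])
  moreover have "g ` f ` S = S" "f ` g ` C = C"
    using assms by (auto simp: homeomorphism_def image_image)
  ultimately show "C \<in> (`) f ` components S" by (metis imageI)
qed (use component_image[OF assms] in auto)

section \<open>Attaching an ear\<close>

text \<open>Here \<open>R\<close> is an ear joining two points \<open>u\<close>, \<open>v\<close> of \<open>M\<close>. Removing a point of \<open>R\<close> leaves every
  remaining piece of \<open>R\<close> attached to \<open>u\<close> or \<open>v\<close>, hence to \<open>M\<close>; so the ear contributes no cut point,
  and only cut points of \<open>M\<close> can survive.\<close>
lemma cutset_ear: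
  assumes "connected R" "connected M" "u \<noteq> v" "u \<in> R" "v \<in> R" "u \<in> M" "v \<in> M"
    and ends: "\<And>p. p \<in> R \<Longrightarrow> connected (R - {p}) \<or>
      (\<exists>S T. R - {p} = S \<union> T \<and> connected S \<and> connected T \<and> u \<in> S \<and> v \<in> T)"
  shows "cutset (R \<union> M) \<subseteq> cutset M"
proof
  fix p assume p: "p \<in> cutset (R \<union> M)"
  show "p \<in> cutset M"
  proof (rule ccontr)
    assume "p \<notin> cutset M"
    then have M: "connected (M - {p})"
      using assms(2) by (cases "p \<in> M") (auto simp: cutset_def)
    have R: "connected (R - {p}) \<or>
      (\<exists>S T. R - {p} = S \<union> T \<and> connected S \<and> connected T \<and> u \<in> S \<and> v \<in> T)"
      using ends assms(1) by (cases "p \<in> R") auto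
    have "connected ((R - {p}) \<union> (M - {p}))"
      using R
    proof
      assume "connected (R - {p})"
      moreover have "(R - {p}) \<inter> (M - {p}) \<noteq> {}" using assms(3-7) by blast
      ultimately show ?thesis using M by (intro connected_Un)
    next
      assume "\<exists>S T. R - {p} = S \<union> T \<and> connected S \<and> connected T \<and> u \<in> S \<and> v \<in> T"
      then obtain S T where ST: "R - {p} = S \<union> T" "connected S" "connected T" "u \<in> S" "v \<in> T" by blast
      have "connected (S \<union> (M - {p}))" "connected (T \<union> (M - {p}))"
        by (intro connected_Un; use ST M assms(6,7) in blast)+
      then have "connected ((S \<union> (M - {p})) \<union> (T \<union> (M - {p})))"
        by (rule connected_Un) (use ST assms(6) in blast)
      moreover have "(S \<union> (M - {p})) \<union> (T \<union> (M - {p})) = (R - {p}) \<union> (M - {p})" using ST by blast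
      ultimately show ?thesis by simp
    qed
    moreover have "(R - {p}) \<union> (M - {p}) = (R \<union> M) - {p}" by blast
    ultimately show False using p by (simp add: cutset_def)
  qed
qed

text \<open>A cut point of \<open>M\<close> that separates the two ends of the ear does not survive, because the ear
  reconnects the two sides. In a good necklace this is what makes a bound strict.\<close>
lemma not_cutset_ear:
  assumes "connected R" "u \<in> R" "v \<in> R" "p \<notin> R"
    and "M - {p} = S \<union> T" "connected S" "connected T" "u \<in> S" "v \<in> T"
  shows "p \<notin> cutset (R \<union> M)"
proof -
  have "connected (R \<union> S)" "connected (R \<union> T)"
    by (intro connected_Un; use assms in blast)+
  then have "connected ((R \<union> S) \<union> (R \<union> T))"
    by (rule connected_Un) (use assms in blast)
  moreover have "(R \<union> S) \<union> (R \<union> T) = (R \<union> M) - {p}" using assms by blast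
  ultimately show ?thesis by (simp add: cutset_def)
qed

section \<open>Components of the complement of a pair of points\<close>

text \<open>Local connectedness makes \<open>D\<close> open. If \<open>a\<close> were not in its closure, \<open>D\<close> would be clopen in
  \<open>X - {b}\<close>, which is connected.\<close>
lemma component_minus_pair:
  fixes X :: "'a::metric_space set"
  assumes X: "closed X" "locally connected X" "\<And>p. connected (X - {p})"
    and ab: "a \<in> X" "b \<in> X" "a \<noteq> b" and D: "D \<in> components (X - {a, b})"
  shows "openin (top_of_set X) D" "closure D = insert a (insert b D)"
proof -
  have "openin (top_of_set X) (X - {a,b})"
    unfolding openin_open by (rule exI[of _ "- {a,b}"]) (auto simp: open_Compl finite_imp_closed)
  then show op: "openin (top_of_set X) D"
    using X(2) D locally_connected_open_component by blast
  have DX: "D \<subseteq> X - {a,b}" "D \<noteq> {}" "connected D"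
    using D in_components_subset in_components_nonempty in_components_connected by blast+
  have clX: "closure D \<subseteq> X" using DX(1) X(1) by (meson Diff_subset closure_minimal order_trans)
  have eq: "closure D \<inter> (X - {a,b}) = D"
  proof -
    obtain T where "closed T" "D = (X - {a,b}) \<inter> T"
      using closedin_component[OF D] unfolding closedin_closed by blast
    then show ?thesis using closure_minimal[of D T] closure_subset[of D] by blast
  qed
  have key: "x \<in> closure D" if "x \<in> {a,b}" "y \<in> {a,b}" "x \<noteq> y" for x y
  proof (rule ccontr)
    assume x: "x \<notin> closure D"
    have xy: "{a,b} = {x,y}" using that by blast
    have "closure D \<inter> (X - {y}) = D"
      using eq x closure_subset[of D] DX(1) xy clX by blast
    then have cl: "closedin (top_of_set (X - {y})) D"
      by (metis closedin_closed closed_closure inf.commute)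
    have "D \<subseteq> X - {y}" using DX(1) xy by blast
    then have "openin (top_of_set (X - {y})) D"
      by (rule openin_subset_trans[OF op]) blast
    then have "D = {} \<or> D = X - {y}"
      using X(3)[of y] cl connected_clopen by metis
    then show False using DX xy ab that by blast
  qed
  show "closure D = insert a (insert b D)"
    using key[of a b] key[of b a] ab(3) eq clX closure_subset[of D] by blast
qed

text \<open>Both \<open>a\<close> and \<open>b\<close> are limits of the connected set \<open>D\<close>, so adding either keeps it connected.\<close>
lemma connected_component_minus_pair:
  fixes X :: "'a::metric_space set"
  assumes "closed X" "locally connected X" "\<And>p. connected (X - {p})"
    and "a \<in> X" "b \<in> X" "a \<noteq> b" and D: "D \<in> components (X - {a, b})"
    and "D \<subseteq> E" "E \<subseteq> insert a (insert b D)"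
  shows "connected E"
  using component_minus_pair(2)[OF assms(1-7)] in_components_connected[OF D] assms(8,9)
  by (metis connected_intermediate_closure)

text \<open>Two components \<open>D\<close>, \<open>E\<close> of \<open>X - {a, b}\<close> form a loop through \<open>a\<close> and \<open>b\<close>. A point \<open>p\<close> of \<open>D\<close>
  could only disconnect the loop by cutting off a piece that misses the closure of \<open>E\<close>, and hence
  \<open>a\<close> and \<open>b\<close>; such a piece would be clopen in \<open>X - {p}\<close>.\<close>
lemma cutset_two_components:
  fixes X :: "'a::metric_space set"
  assumes X: "closed X" "locally connected X" "\<And>p. connected (X - {p})"
    and ab: "a \<in> X" "b \<in> X" "a \<noteq> b"
    and D: "D \<in> components (X - {a, b})" and E: "E \<in> components (X - {a, b})" and DE: "D \<noteq> E"
  shows "cutset (closure D \<union> closure E) = {}"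
proof -
  note cm = component_minus_pair[OF X ab]
  note con = connected_component_minus_pair[OF X ab]
  have disj: "D \<inter> E = {}" using D E DE components_nonoverlap by blast
  have sub: "D \<subseteq> X - {a,b}" "E \<subseteq> X - {a,b}" using D E in_components_subset by blast+
  have inner: "connected ((closure G \<union> closure H) - {p})"
    if G: "G \<in> components (X - {a, b})" and H: "H \<in> components (X - {a, b})" 
      and GH: "G \<inter> H = {}" and p: "p \<in> G" for G H p
  proof (rule ccontr)
    let ?M = "(closure G \<union> closure H) - {p}"
    assume "\<not> connected ?M"
    have sub: "G \<subseteq> X - {a,b}" "H \<subseteq> X - {a,b}" using G H in_components_subset by blast+
    have clG: "closure G = insert a (insert b G)" and clH: "closure H = insert a (insert b H)"
      using cm(2) G H by auto
    have M2: "closure H \<subseteq> ?M" "connected (closure H)" "closure H \<noteq> {}"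
      using clH p GH sub connected_imp_connected_closure[OF in_components_connected[OF H]] by auto
    obtain S T where ST: "closed S" "closed T" "?M \<subseteq> S \<union> T" "S \<inter> T \<inter> ?M = {}"
        "S \<inter> ?M \<noteq> {}" "T \<inter> ?M \<noteq> {}"
      using \<open>\<not> connected ?M\<close> unfolding connected_closed by blast
    obtain W where W: "open W" "G = X \<inter> W"
      using cm(1)[OF G] unfolding openin_open by blast
    have contra: False if K: "closed K" "closed L" "?M \<subseteq> K \<union> L" "K \<inter> L \<inter> ?M = {}"
        "K \<inter> ?M \<noteq> {}" "closure H \<inter> K = {}" for K L
    proof -
      have KG: "K \<inter> ?M \<subseteq> G" using K(6) clG clH by blast
      have "K \<inter> ?M = (X - {p}) \<inter> (W \<inter> - L)"
      proof
        show "K \<inter> ?M \<subseteq> (X - {p}) \<inter> (W \<inter> - L)" using KG W(2) K(4) by blast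
        have "(X - {p}) \<inter> W \<subseteq> ?M" using W(2) clG by blast
        then show "(X - {p}) \<inter> (W \<inter> - L) \<subseteq> K \<inter> ?M" using K(3) by blast
      qed
      then have op: "openin (top_of_set (X - {p})) (K \<inter> ?M)"
        using W(1) K(2) unfolding openin_open by (metis open_Compl open_Int)
      have "closure G \<union> closure H \<subseteq> X" unfolding clG clH using sub ab by blast
      then have "K \<inter> ?M = (X - {p}) \<inter> (K \<inter> (closure G \<union> closure H))" by blast
      then have "closedin (top_of_set (X - {p})) (K \<inter> ?M)"
        using K(1) unfolding closedin_closed by (metis closed_Int closed_Un closed_closure)
      then have "K \<inter> ?M = X - {p}"
        using X(3)[of p] op K(5) connected_clopen by metis
      then show False using KG sub p ab by blast
    qed
    \<comment> \<open>The connected closure of the other component lies on one side of the separation.\<close>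
    have "closure H \<inter> S = {} \<or> closure H \<inter> T = {}"
    proof (rule ccontr)
      assume "\<not> ?thesis"
      then show False
        using M2 ST(1-4) connected_closed[of "closure H"] by blast
    qed
    then show False using contra[of S T] contra[of T S] ST by blast
  qed
  show ?thesis
  proof (rule ccontr)
    assume "\<not> ?thesis"
    then obtain p where p: "p \<in> closure D \<union> closure E" "\<not> connected ((closure D \<union> closure E) - {p})"
      by (auto simp: cutset_def)
    have clD: "closure D = insert a (insert b D)" and clE: "closure E = insert a (insert b E)"
      using cm(2) D E by auto
    consider "p \<in> D" | "p \<in> E" | "p = a" | "p = b" using p(1) clD clE by blast
    then show False
    proof cases
      case 1 then show False using inner[OF D E disj] p(2) by blast
    next
      case 2 then show False using inner[OF E D] disj p(2) by (simp add: Un_commute inf_commute)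
    next
      case 3
      have "connected (insert b D)" "connected (insert b E)" by (intro con[OF D] con[OF E]; blast)+
      then have "connected (insert b D \<union> insert b E)" by (rule connected_Un) blast
      moreover have "insert b D \<union> insert b E = (closure D \<union> closure E) - {p}"
        using 3 clD clE sub ab by auto
      ultimately show False using p(2) by simp
    next
      case 4
      have "connected (insert a D)" "connected (insert a E)" by (intro con[OF D] con[OF E]; blast)+
      then have "connected (insert a D \<union> insert a E)" by (rule connected_Un) blast
      moreover have "insert a D \<union> insert a E = (closure D \<union> closure E) - {p}"
        using 4 clD clE sub ab by auto
      ultimately show False using p(2) by simp
    qed
  qed
qed

lemma connected_minus_pair:
  assumes "\<And>p. connected (X - {p})" "\<not> {a, b} \<subseteq> X"
  shows "connected (X - {a, b})"
proof -
  have "X - {a, b} = X - {a} \<or> X - {a, b} = X - {b}" using assms(2) by blast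
  then show ?thesis using assms(1) by metis
qed

text \<open>If \<open>S\<close> and \<open>T\<close> are closed and meet only inside \<open>A\<close>, no connected subset of \<open>X - A\<close> can meet
  both, so the connected set \<open>S - A\<close> is a full component.\<close>
lemma component_of_closed_split:
  assumes C: "C \<in> components (X - A)" and X: "X = S \<union> T" "S \<inter> T \<subseteq> A" "closed S" "closed T"
    and S: "connected (S - A)"
    and meets: "C \<inter> (S - A) \<noteq> {}"
  shows "C = S - A"
proof -
  have "S - A \<subseteq> C" using components_maximal[OF C S] meets X(1) by blast
  moreover have "C \<subseteq> S"
  proof (rule ccontr)
    assume "\<not> C \<subseteq> S"
    moreover have "C \<subseteq> X - A" using C in_components_subset by blast
    ultimately show False
      using in_components_connected[OF C] meets X unfolding connected_closed by blast
  qed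
  moreover have "C \<subseteq> X - A" using C in_components_subset by blast
  ultimately show ?thesis by blast
qed

section \<open>Beads and nodes of a necklace\<close>

locale necklace =
  fixes n :: nat and f :: "nat \<Rightarrow> 'a::euclidean_space \<Rightarrow> 'a" and F :: "'a set" and z :: "nat \<Rightarrow> 'a"
  assumes nifs: "is_NIFS n f F" and main_nodes: "main_nodes n f F z"
    and no_cut_points: "cut_points (top_of_set F) = {}"
begin

text \<open>The family is indexed cyclically by all natural numbers, so that the chain of beads following any
  given bead is a plain interval of indices; \<open>index\<close> picks the representative in \<open>1, \<dots>, n\<close>.\<close>
definition index :: "nat \<Rightarrow> nat" where
  "index i = (if i mod n = 0 then n else i mod n)"

definition bead :: "nat \<Rightarrow> 'a set" where
  "bead i = f (index i) ` F"

definition node :: "nat \<Rightarrow> 'a" where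
  "node i = z (i mod n)"

text \<open>The beads \<open>i + 1, \<dots>, j\<close>, leading from node \<open>i\<close> to node \<open>j\<close> because bead \<open>t\<close> carries the
  nodes \<open>t - 1\<close> and \<open>t\<close>.\<close>
definition chain :: "nat \<Rightarrow> nat \<Rightarrow> 'a set" where
  "chain i j = (\<Union>t\<in>{i<..j}. bead t)"

lemma n_ge_3: "3 \<le> n"
  using nifs by (simp add: is_NIFS_def)

lemma compact_F: "compact F" and F_eq: "F = (\<Union>k\<in>{1..n}. f k ` F)"
  using nifs unfolding is_NIFS_def is_attractor_def by blast+

lemma index_range: "index i \<in> {1..n}"
  using n_ge_3 mod_less_divisor[of n i] by (auto simp: index_def)

lemma index_id: "i \<in> {1..n} \<Longrightarrow> index i = i"
  by (cases "i = n") (auto simp: index_def)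

lemma index_Suc: "index (Suc i) = index i mod n + 1"
  using n_ge_3 by (auto simp: index_def mod_Suc)

lemma index_cong: "i mod n = j mod n \<Longrightarrow> index i = index j"
  by (simp add: index_def)

lemma homeomorphism_f: "\<exists>g. homeomorphism UNIV UNIV (f (index i)) g"
  using nifs index_range by (auto simp: is_NIFS_def)

lemma bead_add_n [simp]: "bead (i + n) = bead i"
  by (simp add: bead_def index_def)

lemma node_add_n [simp]: "node (i + n) = node i"
  by (simp add: node_def)

lemma node_eq_z: "i \<le> n \<Longrightarrow> node i = z i"
  using main_nodes by (cases "i = n") (auto simp: node_def main_nodes_def)

lemma node_eq_iff: "node i = node j \<longleftrightarrow> i mod n = j mod n"
proof -
  have z: "node i = z (index i)" for i
    using main_nodes by (auto simp: main_nodes_def index_def node_def)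
  have "i mod n \<noteq> n" "j mod n \<noteq> n" using n_ge_3 mod_less_divisor[of n] by (metis less_irrefl not_gr0 not_numeral_le_zero)+
  then have "index i = index j \<longleftrightarrow> i mod n = j mod n"
    by (auto simp: index_def)
  moreover have "inj_on z {1..n}" using main_nodes by (simp add: main_nodes_def)
  ultimately show ?thesis
    unfolding z using inj_on_eq_iff[OF _ index_range index_range] by blast
qed

lemma node_neq:
  assumes "i < j" "j < i + n"
  shows "node i \<noteq> node j"
proof
  assume "node i = node j"
  then have "j mod n = i mod n" by (simp add: node_eq_iff)
  then have "n dvd j - i" using assms by (simp add: mod_eq_dvd_iff_nat)
  then have "n \<le> j - i" using assms by (intro dvd_imp_le) auto
  then show False using assms by simp
qed

lemma bead_Int_Suc: "bead i \<inter> bead (Suc i) = {node i}"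
proof -
  have "node i = z (index i)"
    using main_nodes by (auto simp: node_def index_def main_nodes_def)
  then show ?thesis
    using main_nodes index_range[of i] by (simp add: bead_def index_Suc main_nodes_def)
qed

lemma node_in_bead: "node i \<in> bead i" and node_in_bead_Suc: "node i \<in> bead (Suc i)"
  using bead_Int_Suc[of i] by auto

text \<open>The two indices differ cyclically by at least 2; the representatives in \<open>1, \<dots>, n\<close> then differ by a
  number between 2 and \<open>n - 2\<close>, whether or not the interval from \<open>i\<close> to \<open>j\<close> wraps around.\<close>
lemma bead_disjoint:
  assumes "i + 2 \<le> j" "j + 2 \<le> i + n"
  shows "bead i \<inter> bead j = {}"
proof -
  obtain d where d: "j = i + d" "2 \<le> d" "d + 2 \<le> n"
    using assms by (intro that[of "j - i"]) auto
  let ?i = "index i" and ?j = "index j"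
  have r: "?i \<in> {1..n}" "?j \<in> {1..n}" using index_range by auto
  have "?j = (if ?i + d \<le> n then ?i + d else ?i + d - n)"
  proof -
    have im: "?i mod n = i mod n" by (simp add: index_def)
    have "?j = index (?i + d)" unfolding d(1) by (rule index_cong) (metis im mod_add_left_eq)
    also have "\<dots> = (if ?i + d \<le> n then ?i + d else ?i + d - n)"
    proof (cases "?i + d \<le> n")
      case True then show ?thesis using r by (simp add: index_id)
    next
      case False
      then have "index (?i + d) = index (?i + d - n)" by (intro index_cong) (simp add: le_mod_geq)
      also have "\<dots> = ?i + d - n" using False r d by (intro index_id) auto
      finally show ?thesis using False by simp
    qed
    finally show ?thesis .
  qed
  then have "2 \<le> \<bar>int ?i - int ?j\<bar>" "\<bar>int ?i - int ?j\<bar> \<le> int n - 2" "?i \<noteq> ?j"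
    using d r by (auto split: if_splits)
  moreover have "\<forall>m\<in>{1..n}. \<forall>k\<in>{1..n}. m \<noteq> k \<longrightarrow> 
      2 \<le> \<bar>int m - int k\<bar> \<and> \<bar>int m - int k\<bar> \<le> int n - 2 \<longrightarrow> f m ` F \<inter> f k ` F = {}"
    using nifs unfolding is_NIFS_def by blast
  ultimately show ?thesis
    using r by (simp add: bead_def)
qed

lemma bead_Int:
  assumes "s < t" "t < s + n"
  shows "bead s \<inter> bead t = (if t = Suc s then {node s} else if Suc t = s + n then {node t} else {})"
proof -
  have "bead s \<inter> bead t = {node t}" if "Suc t = s + n"
    using bead_Int_Suc[of t] that by (metis bead_add_n inf_commute)
  then show ?thesis
    using assms bead_Int_Suc[of s] bead_disjoint[of s t] by auto
qed

text \<open>Any \<open>n\<close> consecutive indices meet every residue class.\<close>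
lemma beads_cover: "F = chain j (j + n)"
proof -
  have "\<exists>t\<in>{j<..j+n}. index t = k" if k: "k \<in> {1..n}" for k
  proof -
    \<comment> \<open>The index in the window that is congruent to \<open>k\<close>; adding a multiple of \<open>n\<close> keeps the subtraction exact.\<close>
    define t where "t = j + 1 + (k + n * (j + 1) - (j + 1)) mod n"
    have le: "j + 1 \<le> k + n * (j + 1)" 
      using n_ge_3 mult_le_mono1[of 1 n "j + 1"] by (intro trans_le_add2) simp
    have "t mod n = (j + 1 + (k + n * (j + 1) - (j + 1))) mod n"
      unfolding t_def by (rule mod_add_right_eq)
    also have "\<dots> = (k + n * (j + 1)) mod n" by (simp only: le_add_diff_inverse[OF le])
    also have "\<dots> = k mod n" by (simp only: mod_mult_self2)
    finally have "index t = k" using k index_id index_cong by metis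
    moreover have "t \<in> {j<..j+n}"
      using n_ge_3 mod_less_divisor[of n "k + n * (j + 1) - (j + 1)"]
      unfolding t_def greaterThanAtMost_iff by linarith
    ultimately show ?thesis by blast
  qed
  then have "(\<Union>k\<in>{1..n}. f k ` F) \<subseteq> chain j (j + n)"
    unfolding chain_def bead_def by fastforce
  moreover have "chain j (j + n) \<subseteq> (\<Union>k\<in>{1..n}. f k ` F)"
    using index_range unfolding chain_def bead_def by blast
  ultimately show ?thesis using F_eq by simp
qed

lemma bead_subset_F: "bead i \<subseteq> F"
proof -
  have "bead i \<subseteq> (\<Union>k\<in>{1..n}. f k ` F)" using index_range unfolding bead_def by blast
  then show ?thesis using F_eq by simp
qed

section \<open>Connectedness and local connectedness\<close>

text \<open>The largest of finitely many contraction ratios serves for all maps at once.\<close>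
lemma contraction:
  obtains c where "0 < c" "c < 1" "\<And>i x y. dist (f (index i) x) (f (index i) y) \<le> c * dist x y"
proof -
  have "\<forall>k\<in>{1..n}. \<exists>c. 0 < c \<and> c < 1 \<and> (\<forall>x y. dist (f k x) (f k y) \<le> c * dist x y)"
    using nifs by (simp add: is_NIFS_def contracting_def)
  then obtain c where c: "\<And>k. k \<in> {1..n} \<Longrightarrow> 0 < c k \<and> c k < 1 \<and> (\<forall>x y. dist (f k x) (f k y) \<le> c k * dist x y)"
    by metis
  let ?c = "Max (c ` {1..n})"
  have fin: "finite (c ` {1..n})" "c ` {1..n} \<noteq> {}" using n_ge_3 by auto
  have "?c \<in> c ` {1..n}" using fin by (rule Max_in)
  then have "0 < ?c" "?c < 1" using c by auto
  moreover have "dist (f (index i) x) (f (index i) y) \<le> ?c * dist x y" for i x y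
  proof -
    have "c (index i) \<le> ?c" using fin index_range by (intro Max_ge) auto
    then have "c (index i) * dist x y \<le> ?c * dist x y" by (rule mult_right_mono) simp
    then show ?thesis using c[OF index_range[of i]] by (meson order_trans)
  qed
  ultimately show ?thesis using that by blast
qed

lemma bounded_F:
  obtains D where "\<And>x y. x \<in> F \<Longrightarrow> y \<in> F \<Longrightarrow> dist x y \<le> D" "0 < D"
proof
  show "dist x y \<le> diameter F + 1" if "x \<in> F" "y \<in> F" for x y
    using diameter_bounded_bound[OF compact_imp_bounded[OF compact_F] that] by simp
  show "0 < diameter F + 1"
    using diameter_ge_0[OF compact_imp_bounded[OF compact_F]] by simp
qed

text \<open>If \<open>F\<close> were split into two parts, some bead would be split too, since consecutive beads share a
  node. Pulling the split back through the bead map and repeating shows that the two parts come within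
  \<open>c\<^sup>m D\<close> of each other for all \<open>m\<close>, whereas disjoint compact sets have positive distance.\<close>
lemma connected_F: "connected F"
proof (rule ccontr)
  assume "\<not> connected F"
  then obtain A B where AB: "closed A" "closed B" "F \<subseteq> A \<union> B" "A \<inter> B \<inter> F = {}"
      "A \<inter> F \<noteq> {}" "B \<inter> F \<noteq> {}"
    unfolding connected_closed by blast
  have "compact (A \<inter> F)" "closed (B \<inter> F)"
    using AB compact_F by (auto intro: compact_imp_closed compact_Int_closed closed_Int_compact closed_Int)
  then obtain d where d: "0 < d" "\<And>x y. x \<in> A \<inter> F \<Longrightarrow> y \<in> B \<inter> F \<Longrightarrow> d \<le> dist x y"
    using separate_compact_closed[of "A \<inter> F" "B \<inter> F"] AB(4) by blast
  obtain c where c: "0 < c" "c < 1" "\<And>i x y. dist (f (index i) x) (f (index i) y) \<le> c * dist x y"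
    by (rule contraction) blast
  obtain D where D: "\<And>x y. x \<in> F \<Longrightarrow> y \<in> F \<Longrightarrow> dist x y \<le> D" "0 < D"
    by (rule bounded_F) blast
  have close: "\<exists>x\<in>U. \<exists>y\<in>V. dist x y \<le> c ^ m * D" if "F = U \<union> V" "U \<noteq> {}" "V \<noteq> {}" for m U V
    using that
  proof (induction m arbitrary: U V)
    case 0
    then obtain x y where "x \<in> U" "y \<in> V" by blast
    then show ?case using D(1)[of x y] 0 by auto
  next
    case (Suc m)
    have pos: "0 \<le> c ^ Suc m * D" using c D by simp
    show ?case
    proof (cases "\<exists>i. bead i \<inter> U \<noteq> {} \<and> bead i \<inter> V \<noteq> {}")
      case True
      then obtain i where i: "bead i \<inter> U \<noteq> {}" "bead i \<inter> V \<noteq> {}" by blast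
      let ?g = "f (index i)"
      have "F = {x\<in>F. ?g x \<in> U} \<union> {x\<in>F. ?g x \<in> V}"
        using bead_subset_F[of i] Suc.prems(1) unfolding bead_def by blast
      moreover have "{x\<in>F. ?g x \<in> U} \<noteq> {}" "{x\<in>F. ?g x \<in> V} \<noteq> {}"
        using i unfolding bead_def by blast+
      ultimately obtain x y where xy: "?g x \<in> U" "?g y \<in> V" "dist x y \<le> c ^ m * D"
        using Suc.IH by blast
      have "dist (?g x) (?g y) \<le> c * dist x y" using c(3) by blast
      also have "\<dots> \<le> c * (c ^ m * D)" using xy(3) c(1) by simp
      finally show ?thesis using xy by (auto simp: mult.assoc)
    next
      case False
      have sub: "bead i \<subseteq> U \<or> bead i \<subseteq> V" for i
        using False bead_subset_F[of i] Suc.prems(1) by blast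
      show ?thesis
      proof (rule ccontr)
        assume no: "\<not> ?thesis"
        have disj: "U \<inter> V = {}"
        proof (rule ccontr)
          assume "U \<inter> V \<noteq> {}"
          then obtain x where "x \<in> U" "x \<in> V" by blast
          then show False using no pos dist_self[of x] by (metis (no_types))
        qed
        have "bead (Suc i) \<subseteq> U \<longleftrightarrow> bead i \<subseteq> U" for i
          using sub[of i] sub[of "Suc i"] node_in_bead[of i] node_in_bead_Suc[of i] disj by blast
        then have "bead i \<subseteq> U \<longleftrightarrow> bead 0 \<subseteq> U" for i by (induction i) auto
        moreover have "bead i \<noteq> {}" for i using node_in_bead by blast
        ultimately have "chain 0 (0 + n) \<subseteq> U \<or> chain 0 (0 + n) \<subseteq> V"
          using sub disj unfolding chain_def by blast
        then have "F \<subseteq> U \<or> F \<subseteq> V" using beads_cover[of 0] by simp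
        then show False using Suc.prems disj by blast
      qed
    qed
  qed
  have "F = (A \<inter> F) \<union> (B \<inter> F)" using AB by blast
  then have le: "d \<le> c ^ m * D" for m
    using close[of "A \<inter> F" "B \<inter> F" m] d(2) AB(5,6) by (meson order_trans)
  have "(\<lambda>m. c ^ m * D) \<longlonglongrightarrow> 0"
    using c by (intro tendsto_mult_left_zero LIMSEQ_power_zero) auto
  then have "d \<le> 0" using le by (intro LIMSEQ_le_const) auto
  then show False using d(1) by simp
qed

text \<open>For every \<open>m\<close>, \<open>F\<close> is a finite union of closed connected pieces of diameter at most \<open>c\<^sup>m D\<close>, the
  \<open>m\<close>-fold images of \<open>F\<close>. The pieces through \<open>x\<close> form a small neighbourhood of \<open>x\<close> in which every
  point shares a connected piece with \<open>x\<close>.\<close>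
lemma locally_connected_F: "locally connected F"
proof -
  obtain c where c: "0 < c" "c < 1" "\<And>i x y. dist (f (index i) x) (f (index i) y) \<le> c * dist x y"
    by (rule contraction) blast
  obtain D where D: "\<And>x y. x \<in> F \<Longrightarrow> y \<in> F \<Longrightarrow> dist x y \<le> D" "0 < D"
    by (rule bounded_F) blast
  have pieces: "\<exists>\<K>. finite \<K> \<and> \<Union>\<K> = F \<and>
      (\<forall>K\<in>\<K>. connected K \<and> closed K \<and> (\<forall>x\<in>K. \<forall>y\<in>K. dist x y \<le> c ^ m * D))" for m
  proof (induction m)
    case 0
    show ?case using D connected_F compact_imp_closed[OF compact_F] by (intro exI[of _ "{F}"]) auto
  next
    case (Suc m)
    then obtain \<K> where K: "finite \<K>" "\<Union>\<K> = F" "\<And>K. K \<in> \<K> \<Longrightarrow> connected K \<and> closed K"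
        "\<And>K x y. K \<in> \<K> \<Longrightarrow> x \<in> K \<Longrightarrow> y \<in> K \<Longrightarrow> dist x y \<le> c ^ m * D"
      by metis
    let ?K = "\<Union>i\<in>{0<..n}. (`) (f (index i)) ` \<K>"
    have "\<Union>?K = chain 0 (0 + n)"
    proof -
      have "\<Union>?K = (\<Union>i\<in>{0<..n}. f (index i) ` \<Union>\<K>)" by blast
      then show ?thesis by (simp add: K(2) chain_def bead_def)
    qed
    then have "\<Union>?K = F" using beads_cover[of 0] by simp
    moreover have "connected (f (index i) ` K) \<and> closed (f (index i) ` K)" if "K \<in> \<K>" for i K
      using K(3)[OF that] homeomorphism_f[of i] homeomorphism_connected_image homeomorphism_closure_image
      by (metis closure_closed closed_closure)
    moreover have "dist (f (index i) x) (f (index i) y) \<le> c ^ Suc m * D" if "K \<in> \<K>" "x \<in> K" "y \<in> K" for i K x y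
    proof -
      have "dist (f (index i) x) (f (index i) y) \<le> c * dist x y" by (rule c(3))
      also have "\<dots> \<le> c * (c ^ m * D)" using K(4)[OF that] c(1) by simp
      finally show ?thesis by (simp add: mult.assoc)
    qed
    ultimately show ?case using K(1) by (intro exI[of _ ?K]) auto
  qed
  show ?thesis
    unfolding locally_connected_im_kleinen
  proof (intro allI impI)
    fix V x assume V: "openin (top_of_set F) V \<and> x \<in> V"
    then obtain e where e: "0 < e" "ball x e \<inter> F \<subseteq> V"
      unfolding openin_contains_ball by auto
    have xF: "x \<in> F" using V openin_imp_subset by blast
    have "(\<lambda>m. c ^ m * D) \<longlonglongrightarrow> 0"
      using c by (intro tendsto_mult_left_zero LIMSEQ_power_zero) auto
    then obtain m where m: "c ^ m * D < e"
      using order_tendstoD(2)[OF _ e(1)] eventually_sequentially by (metis order_refl)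
    obtain \<K> where K: "finite \<K>" "\<Union>\<K> = F" "\<And>K. K \<in> \<K> \<Longrightarrow> connected K \<and> closed K"
        "\<And>K x y. K \<in> \<K> \<Longrightarrow> x \<in> K \<Longrightarrow> y \<in> K \<Longrightarrow> dist x y \<le> c ^ m * D"
      using pieces[of m] by metis
    \<comment> \<open>The union of the pieces that miss \<open>x\<close> is closed, so its complement is a neighbourhood of \<open>x\<close>.\<close>
    define C where "C = \<Union>{K \<in> \<K>. x \<notin> K}"
    have "closed C" unfolding C_def using K by (intro closed_Union) auto
    have KV: "K \<subseteq> V" if "K \<in> \<K>" "x \<in> K" for K
    proof
      fix y assume "y \<in> K"
      then have "dist x y < e" using K(4)[OF that \<open>y \<in> K\<close>] m by simp
      moreover have "y \<in> F" using \<open>y \<in> K\<close> that K(2) by blast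
      ultimately show "y \<in> V" using e(2) by auto
    qed
    have in_piece: "\<exists>K\<in>\<K>. x \<in> K \<and> y \<in> K" if "y \<in> F - C" for y
      using that K(2) unfolding C_def by blast
    have "openin (top_of_set F) (F - C)"
      using \<open>closed C\<close> unfolding openin_open by (metis Diff_eq open_Compl)
    moreover have "x \<in> F - C" using xF by (auto simp: C_def)
    moreover have "F - C \<subseteq> V" using in_piece KV by blast
    moreover have "\<forall>y. y \<in> F - C \<longrightarrow> (\<exists>c. connected c \<and> c \<subseteq> V \<and> x \<in> c \<and> y \<in> c)"
      using in_piece KV K(3) by meson
    ultimately show "\<exists>u. openin (top_of_set F) u \<and> x \<in> u \<and> u \<subseteq> V \<and>
        (\<forall>y. y \<in> u \<longrightarrow> (\<exists>c. connected c \<and> c \<subseteq> V \<and> x \<in> c \<and> y \<in> c))"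
      by blast
  qed
qed

lemma cutset_F: "cutset F = {}"
  using no_cut_points cut_points_top_of_set[OF connected_F] by simp

lemma connected_F_minus: "connected (F - {p})"
  using connected_F cutset_F by (cases "p \<in> F") (auto simp: cutset_def)

lemma closed_bead: "closed (bead i)"
  using homeomorphism_f[of i] homeomorphism_closure_image compact_imp_closed[OF compact_F]
  unfolding bead_def by (metis closure_closed closed_closure)

lemma connected_bead: "connected (bead i)"
  using homeomorphism_f[of i] connected_F homeomorphism_connected_image unfolding bead_def by metis

lemma connected_bead_minus: "connected (bead i - {p})"
proof -
  obtain g where g: "homeomorphism UNIV UNIV (f (index i)) g" using homeomorphism_f by blast
  have "cutset (bead i) = {}" unfolding bead_def by (simp add: cutset_image[OF g] cutset_F)
  then show ?thesis using connected_bead by (cases "p \<in> bead i") (auto simp: cutset_def)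
qed

lemma locally_connected_bead: "locally connected (bead i)"
proof -
  obtain g where g: "homeomorphism UNIV UNIV (f (index i)) g" using homeomorphism_f by blast
  have "homeomorphism F (bead i) (f (index i)) g"
    using homeomorphism_of_subsets[OF g] by (simp add: bead_def)
  then show ?thesis
    using homeomorphism_locally[of F "bead i" "f (index i)" g connected connected] locally_connected_F
      homeomorphic_connectedness homeomorphic_def by blast
qed

section \<open>Chains of consecutive beads\<close>

lemma chain_single: "chain i (Suc i) = bead (Suc i)"
proof -
  have "{i<..Suc i} = {Suc i}" by auto
  then show ?thesis by (simp add: chain_def)
qed

lemma chain_split: "i \<le> t \<Longrightarrow> t \<le> j \<Longrightarrow> chain i j = chain i t \<union> chain t j"
proof -
  assume "i \<le> t" "t \<le> j"
  then have "{i<..j} = {i<..t} \<union> {t<..j}" by auto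
  then show ?thesis by (simp add: chain_def)
qed

lemma closed_chain: "closed (chain i j)"
  unfolding chain_def by (intro closed_UN) (auto simp: closed_bead)

lemma chain_subset_F: "chain i j \<subseteq> F"
  using bead_subset_F by (auto simp: chain_def)

lemma node_in_chain: "i \<le> t \<Longrightarrow> t \<le> j \<Longrightarrow> i < j \<Longrightarrow> node t \<in> chain i j"
  using node_in_bead[of t] node_in_bead_Suc[of t] unfolding chain_def
  by (cases "t = i") (auto intro: bexI[of _ "Suc i"])

lemma chain_minus_connected:
  assumes "i < j"
    and "\<And>t. i < t \<Longrightarrow> t \<le> j \<Longrightarrow> connected (bead t - S)"
    and "\<And>t. i < t \<Longrightarrow> t < j \<Longrightarrow> node t \<notin> S"
  shows "connected (chain i j - S)"
  using assms
proof (induction j)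
  case (Suc j)
  show ?case
  proof (cases "i = j")
    case True then show ?thesis using Suc.prems(2)[of "Suc j"] by (simp add: chain_single)
  next
    case False
    then have ij: "i < j" using Suc.prems(1) by simp
    have "connected (chain i j - S)" using ij Suc.prems by (intro Suc.IH) auto
    moreover have "connected (bead (Suc j) - S)" using Suc.prems by simp
    moreover have "(chain i j - S) \<inter> (bead (Suc j) - S) \<noteq> {}"
      using node_in_chain[of i j j] node_in_bead_Suc[of j] Suc.prems(3)[of j] ij by auto
    ultimately have "connected ((chain i j - S) \<union> (bead (Suc j) - S))" by (rule connected_Un)
    moreover have "chain i (Suc j) = chain i j \<union> bead (Suc j)"
      using chain_split[of i j "Suc j"] ij by (simp add: chain_single)
    ultimately show ?thesis by (simp add: Un_Diff)
  qed
qed simp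

lemma chain_connected: "i < j \<Longrightarrow> connected (chain i j)"
  using chain_minus_connected[of i j "{}"] connected_bead by simp

lemma chain_minus_point_connected:
  "i < j \<Longrightarrow> (\<And>t. i < t \<Longrightarrow> t < j \<Longrightarrow> node t \<noteq> p) \<Longrightarrow> connected (chain i j - {p})"
  using connected_bead_minus by (intro chain_minus_connected) auto

lemma chain_Int:
  assumes "i < t" "t < j" "j < i + n"
  shows "chain i t \<inter> chain t j = {node t}"
proof
  show "{node t} \<subseteq> chain i t \<inter> chain t j" using assms node_in_chain by auto
  show "chain i t \<inter> chain t j \<subseteq> {node t}"
  proof
    fix x assume "x \<in> chain i t \<inter> chain t j"
    then obtain r s where rs: "i < r" "r \<le> t" "t < s" "s \<le> j" "x \<in> bead r \<inter> bead s"
      by (auto simp: chain_def)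
    then have "s = Suc r" "x = node r"
      using bead_Int[of r s] assms by (auto split: if_splits)
    then show "x \<in> {node t}" using rs by (auto intro: arg_cong[of r t node])
  qed
qed

text \<open>Besides the bead indices next to each other at \<open>j\<close>, also the first index \<open>i + 1\<close> and the last
  index \<open>i + n\<close> are cyclically adjacent, so the two chains meet at both ends.\<close>
lemma chain_Int_complement:
  assumes "i < j" "j < i + n"
  shows "chain i j \<inter> chain j (i + n) = {node i, node j}"
proof
  show "{node i, node j} \<subseteq> chain i j \<inter> chain j (i + n)"
    using assms node_in_chain[of i i j] node_in_chain[of i j j] node_in_chain[of j j "i + n"]
      node_in_chain[of j "i + n" "i + n"] by auto
  show "chain i j \<inter> chain j (i + n) \<subseteq> {node i, node j}"
  proof
    fix x assume "x \<in> chain i j \<inter> chain j (i + n)"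
    then obtain r s where rs: "i < r" "r \<le> j" "j < s" "s \<le> i + n" "x \<in> bead r \<inter> bead s"
      by (auto simp: chain_def)
    then consider "s = Suc r" "x = node r" | "Suc s = r + n" "x = node s"
      using bead_Int[of r s] by (auto split: if_splits)
    then show "x \<in> {node i, node j}"
    proof cases
      case 1 then have "r = j" using rs by simp
      then show ?thesis using 1 by simp
    next
      case 2 then have "s = i + n" using rs by simp
      then show ?thesis using 2 by simp
    qed
  qed
qed

lemma chain_minus_inner_node:
  assumes "i < t" "t < j" "j < i + n"
  shows "chain i j - {node t} = (chain i t - {node t}) \<union> (chain t j - {node t})"
    and "connected (chain i t - {node t})" and "connected (chain t j - {node t})"
    and "node i \<in> chain i t - {node t}" and "node j \<in> chain t j - {node t}"
proof -
  show "chain i j - {node t} = (chain i t - {node t}) \<union> (chain t j - {node t})"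
    using chain_split[of i t j] assms by auto
  show "connected (chain i t - {node t})"
    using assms node_neq[of _ t] by (intro chain_minus_point_connected) auto
  show "connected (chain t j - {node t})"
    using assms node_neq[of t] by (intro chain_minus_point_connected) force+
  show "node i \<in> chain i t - {node t}" "node j \<in> chain t j - {node t}"
    using assms node_in_chain node_neq[of i t] node_neq[of t j] by auto
qed

text \<open>The cut points of a proper chain are exactly the nodes strictly inside it: an inner node is the
  only link between the two parts of the chain, and any other point can be removed because no bead has
  cut points.\<close>
lemma cutset_chain:
  assumes "i < j" "j < i + n"
  shows "cutset (chain i j) = node ` {i<..<j}"
proof (intro subset_antisym subsetI)
  fix p assume "p \<in> cutset (chain i j)"
  then have "\<not> connected (chain i j - {p})" by (simp add: cutset_def)
  then obtain t where "i < t" "t < j" "node t = p"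
    using chain_minus_point_connected[OF assms(1)] by blast
  then show "p \<in> node ` {i<..<j}" by auto
next
  fix p assume "p \<in> node ` {i<..<j}"
  then obtain t where t: "i < t" "t < j" "p = node t" by auto
  note A = chain_minus_inner_node[OF t(1,2) assms(2)]
  have "\<not> connected (chain i j - {p})"
    unfolding connected_closed
  proof (intro notI, elim notE, intro exI conjI)
    show "closed (chain i t)" "closed (chain t j)" by (rule closed_chain)+
  qed (use A t chain_Int[OF t(1,2) assms(2)] in auto)
  then show "p \<in> cutset (chain i j)"
    using node_in_chain t by (auto simp: cutset_def)
qed

lemma card_cutset_chain:
  assumes "i < j" "j < i + n"
  shows "finite (cutset (chain i j))" "card (cutset (chain i j)) = j - i - 1"
proof -
  have "inj_on node {i<..<j}"
    using node_neq assms(2) by (intro linorder_inj_onI) force+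
  then show "finite (cutset (chain i j))" "card (cutset (chain i j)) = j - i - 1"
    unfolding cutset_chain[OF assms] by (simp_all add: card_image)
qed

text \<open>This is the hypothesis on the ear in \<open>cutset_ear\<close>.\<close>
lemma chain_ends:
  assumes "i < j" "j < i + n"
  shows "connected (chain i j - {p}) \<or>
    (\<exists>S T. chain i j - {p} = S \<union> T \<and> connected S \<and> connected T \<and> node i \<in> S \<and> node j \<in> T)"
proof (cases "\<exists>t. i < t \<and> t < j \<and> p = node t")
  case True
  then obtain t where "i < t" "t < j" "p = node t" by blast
  then show ?thesis using chain_minus_inner_node[of i t j] assms(2) by blast
next
  case False
  then show ?thesis using chain_minus_point_connected[of i j p] assms(1) by blast
qed

text \<open>Order the two points along the chain. The node at the end of the bead of the first point separates
  them unless it is that point itself, in which case the next bead also contains the point and its end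
  node separates them.\<close>
lemma chain_separates:
  assumes "x \<in> chain i j" "y \<in> chain i j" "j < i + n" and sep: "\<And>t. \<not> (x \<in> bead t \<and> y \<in> bead t)"
  shows "\<exists>s. i < s \<and> s < j \<and>
    (x \<in> chain i s - {node s} \<and> y \<in> chain s j - {node s} \<or> y \<in> chain i s - {node s} \<and> x \<in> chain s j - {node s})"
proof -
  have ordered: "\<exists>s. i < s \<and> s < j \<and> x \<in> chain i s - {node s} \<and> y \<in> chain s j - {node s}"
    if r: "i < r" "r < t" "t \<le> j" "x \<in> bead r" "y \<in> bead t"
      and sep: "\<And>t. \<not> (x \<in> bead t \<and> y \<in> bead t)" for x y r t
  proof -
    \<comment> \<open>The last bead that contains \<open>x\<close> among \<open>r\<close> and its successor.\<close>
    define s where "s = (if x = node r then Suc r else r)"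
    have xs: "x \<in> bead s" "x \<noteq> node s"
      using r node_in_bead_Suc[of r] node_neq[of r "Suc r"] n_ge_3 by (auto simp: s_def)
    have "s < t" using r sep[of t] xs(1) by (auto simp: s_def intro: Suc_lessI)
    moreover have "y \<noteq> node s" using sep[of s] xs(1) node_in_bead[of s] by blast
    moreover have "i < s" using r by (simp add: s_def)
    ultimately show ?thesis
      using xs r by (intro exI[of _ s]) (auto simp: chain_def)
  qed
  obtain r t where rt: "i < r" "r \<le> j" "x \<in> bead r" "i < t" "t \<le> j" "y \<in> bead t"
    using assms(1,2) by (auto simp: chain_def)
  have "r \<noteq> t" using rt sep by blast
  then consider "r < t" | "t < r" by linarith
  then show ?thesis
  proof cases
    case 1 then show ?thesis using ordered[of r t x y] rt sep by blast
  next
    case 2 then show ?thesis using ordered[of t r y x] rt sep by blast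
  qed
qed

section \<open>The bound on cut points\<close>

text \<open>Bead \<open>k + 1\<close> has relative boundary consisting of the nodes \<open>k\<close> and \<open>k + 1\<close>; goodness says that
  no sub-bead contains both.\<close>
definition good :: bool where
  "good \<longleftrightarrow> (\<forall>k j. \<not> {node k, node (Suc k)} \<subseteq> f (index (Suc k)) ` bead j)"

text \<open>The statement proved by self-similarity for the closure \<open>M\<close> of a component of \<open>F - {a, b}\<close>. It
  concerns all pairs \<open>a\<close>, \<open>b\<close>, not only cuts, and records for which component equality occurs, since
  zooming into a bead may lead to a pair that is no cut, or to a pair of adjacent nodes.\<close>
definition bounded_cutset :: "'a \<Rightarrow> 'a \<Rightarrow> 'a set \<Rightarrow> bool" where
  "bounded_cutset a b M \<longleftrightarrow> finite (cutset M) \<and> card (cutset M) \<le> n - 2 \<and>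
     (good \<and> card (cutset M) = n - 2 \<longrightarrow>
       (\<exists>k. {a, b} = {node k, node (Suc k)} \<and> M = chain (Suc k) (k + n)))"

lemma bounded_cutsetI:
  "finite (cutset M) \<Longrightarrow> card (cutset M) < n - 2 \<Longrightarrow> bounded_cutset a b M"
  by (auto simp: bounded_cutset_def)

lemmas F_component = component_minus_pair[OF compact_imp_closed[OF compact_F] locally_connected_F connected_F_minus]
lemmas bead_component = component_minus_pair[OF closed_bead locally_connected_bead connected_bead_minus]

text \<open>Two nodes that share no bead split \<open>F\<close> into two chains of at most \<open>n - 2\<close> beads each.\<close>
lemma bounded_cutset_two_nodes:
  assumes ij: "i < j" "j < i + n" and sep: "\<And>t. \<not> {node i, node j} \<subseteq> bead t"
    and C: "C \<in> components (F - {node i, node j})"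
  shows "bounded_cutset a b (closure C)"
proof -
  let ?A = "{node i, node j}"
  have ne: "j \<noteq> Suc i" "Suc j \<noteq> i + n"
    using sep[of "Suc i"] sep[of "Suc j"] node_in_bead_Suc[of i] node_in_bead[of "Suc i"]
      node_in_bead_Suc[of j] node_in_bead[of "Suc j"] by auto
  have F: "F = chain i j \<union> chain j (i + n)"
    using beads_cover[of i] chain_split[of i j "i + n"] ij by simp
  have con: "connected (bead t - ?A)" for t
    using connected_minus_pair[OF connected_bead_minus sep] by blast
  have P: "connected (chain i j - ?A)"
    using ij con node_neq[of i] node_neq[of _ j] by (intro chain_minus_connected) force+
  have Q: "connected (chain j (i + n) - ?A)"
  proof (intro chain_minus_connected con)
    fix t assume "j < t" "t < i + n"
    then show "node t \<notin> ?A" using ij node_neq[of i t] node_neq[of j t] by auto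
  qed (use ij in auto)
  have nodes: "node i \<in> F" "node j \<in> F" "node i \<noteq> node j"
    using node_in_bead bead_subset_F node_neq[OF ij] by blast+
  have clC: "closure C = insert (node i) (insert (node j) C)"
    using F_component(2)[OF nodes C] .
  have "C \<noteq> {}" "C \<subseteq> F - ?A" using C in_components_nonempty in_components_subset by blast+
  then consider "C \<inter> (chain i j - ?A) \<noteq> {}" | "C \<inter> (chain j (i + n) - ?A) \<noteq> {}"
    using F by blast
  then have "closure C = chain i j \<or> closure C = chain j (i + n)"
  proof cases
    case 1
    have "C = chain i j - ?A"
      by (rule component_of_closed_split[OF C F _ closed_chain closed_chain P 1])
        (simp add: chain_Int_complement[OF ij])
    then show ?thesis unfolding clC using node_in_chain[of i i j] node_in_chain[of i j j] ij by auto
  next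
    case 2
    have "F = chain j (i + n) \<union> chain i j" using F by blast
    then have "C = chain j (i + n) - ?A"
      using chain_Int_complement[OF ij]
      by (intro component_of_closed_split[OF C _ _ closed_chain closed_chain Q 2]) auto
    then show ?thesis
      unfolding clC using node_in_chain[of j j "i + n"] node_in_chain[of j "i + n" "i + n"] ij by auto
  qed
  then show ?thesis
  proof
    assume "closure C = chain i j"
    then show ?thesis using card_cutset_chain[OF ij] ij ne by (intro bounded_cutsetI) auto
  next
    assume "closure C = chain j (i + n)"
    then show ?thesis using card_cutset_chain[of j "i + n"] ij ne by (intro bounded_cutsetI) auto
  qed
qed

text \<open>If one of the two points is not a node, then removing both breaks no bead and at most one link of
  the ring, so the remainder is connected and its closure is \<open>F\<close>.\<close>
lemma bounded_cutset_no_common_bead: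
  assumes ab: "a \<in> F" "b \<in> F" "a \<noteq> b" and sep: "\<And>t. \<not> {a, b} \<subseteq> bead t"
    and C: "C \<in> components (F - {a, b})"
  shows "bounded_cutset a b (closure C)"
proof (cases "a \<in> range node \<and> b \<in> range node")
  case True
  then obtain i' j' where "a = node i'" "b = node j'" by blast
  then obtain i j where ij: "a = node i" "b = node j" "i < n" "j < n"
    using n_ge_3 node_eq_iff by (metis mod_less_divisor mod_mod_trivial not_gr0 not_numeral_le_zero)
  have "i \<noteq> j" using ij ab(3) by blast
  then consider "i < j" | "j < i" by linarith
  then show ?thesis
  proof cases
    case 1 then show ?thesis using bounded_cutset_two_nodes[of i j C a b] ij C sep by simp
  next
    case 2 then show ?thesis using bounded_cutset_two_nodes[of j i C a b] ij C sep
      by (simp add: insert_commute)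
  qed
next
  case False
  then obtain j where j: "\<And>t. node t \<in> {a, b} \<Longrightarrow> node t = node j" by blast
  have "connected (chain j (j + n) - {a, b})"
  proof (rule chain_minus_connected)
    show "connected (bead t - {a, b})" for t
      using connected_minus_pair[OF connected_bead_minus sep] .
    show "node t \<notin> {a, b}" if "j < t" "t < j + n" for t
      using j[of t] node_neq[OF that] by metis
  qed (use n_ge_3 in simp)
  then have "connected (F - {a, b})" using beads_cover[of j] by simp
  then have "C = F - {a, b}"
    using C by (metis components_eq_sing_iff components_empty empty_iff singletonD)
  then have "closure C = F"
    using F_component(2)[OF ab C] ab by auto
  then show ?thesis using n_ge_3 by (intro bounded_cutsetI) (simp_all add: cutset_F)
qed

lemma F_eq_bead_Un_chain: "F = bead (Suc k) \<union> chain (Suc k) (k + n)"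
  using beads_cover[of k] chain_split[of k "Suc k" "k + n"] chain_single[of k] n_ge_3 by simp

lemma bead_Int_chain: "bead (Suc k) \<inter> chain (Suc k) (k + n) = {node k, node (Suc k)}"
  using chain_Int_complement[of k "Suc k"] chain_single[of k] n_ge_3 by simp

text \<open>Every bead of the chain meets bead \<open>k + 1\<close> in at most one point, so it loses at most one of \<open>a\<close>,
  \<open>b\<close>; the inner nodes of the chain lie outside bead \<open>k + 1\<close>.\<close>
lemma connected_complementary_chain_minus:
  assumes ab: "a \<in> bead (Suc k)" "b \<in> bead (Suc k)" "a \<noteq> b"
  shows "connected (chain (Suc k) (k + n) - {a, b})"
proof (rule chain_minus_connected)
  show "Suc k < k + n" using n_ge_3 by simp
next
  fix t assume t: "Suc k < t" "t \<le> k + n"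
  have "\<exists>w. bead (Suc k) \<inter> bead t \<subseteq> {w}"
    using bead_Int[of "Suc k" t] t by (auto split: if_splits)
  then have "\<not> {a, b} \<subseteq> bead t" using ab by blast
  then show "connected (bead t - {a, b})" by (rule connected_minus_pair[OF connected_bead_minus])
next
  fix t assume t: "Suc k < t" "t < k + n"
  then have "node t \<in> chain (Suc k) (k + n)" using node_in_chain by simp
  moreover have "node t \<notin> {node k, node (Suc k)}"
    using node_neq[of k t] node_neq[of "Suc k" t] t by auto
  ultimately have "node t \<notin> bead (Suc k)" using bead_Int_chain[of k] by blast
  then show "node t \<notin> {a, b}" using ab by blast
qed

text \<open>Such a \<open>D\<close> is connected to the rest of the necklace only through the two nodes: without them it
  would be clopen in \<open>C\<close>.\<close>
lemma component_in_bead_meets_nodes: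
  assumes ab: "a \<in> bead (Suc k)" "b \<in> bead (Suc k)" "a \<noteq> b"
    and C: "C \<in> components (F - {a, b})" and CR: "C \<inter> (chain (Suc k) (k + n) - {a, b}) \<noteq> {}"
    and D: "D \<in> components (bead (Suc k) - {a, b})" and DC: "D \<inter> C \<noteq> {}"
  shows "D \<subseteq> C" "node k \<in> D \<or> node (Suc k) \<in> D"
proof -
  let ?B = "bead (Suc k)" and ?R = "chain (Suc k) (k + n)"
  have Dsub: "D \<subseteq> ?B - {a, b}" "connected D"
    using D in_components_subset in_components_connected by blast+
  show DC': "D \<subseteq> C"
    using components_maximal[OF C Dsub(2)] Dsub(1) bead_subset_F DC by blast
  show "node k \<in> D \<or> node (Suc k) \<in> D"
  proof (rule ccontr)
    assume "\<not> ?thesis"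
    moreover have "D \<inter> ?R \<subseteq> ?B \<inter> ?R" using Dsub(1) by blast
    ultimately have DR: "D \<inter> ?R = {}" unfolding bead_Int_chain by blast
    obtain W where W: "open W" "D = ?B \<inter> W"
      using bead_component(1)[OF ab D] unfolding openin_open by blast
    have clD: "closure D = insert a (insert b D)" by (rule bead_component(2)[OF ab D])
    have "closed (?R \<union> (?B \<inter> - W))" using W(1) by (intro closed_Un closed_Int closed_chain closed_bead closed_Compl)
    moreover have "C \<subseteq> F - {a, b}" using C in_components_subset by blast
    moreover have "C \<subseteq> closure D \<union> (?R \<union> (?B \<inter> - W))"
      using \<open>C \<subseteq> F - {a, b}\<close> F_eq_bead_Un_chain[of k] W(2) closure_subset[of D] by blast
    moreover have "closure D \<inter> (?R \<union> (?B \<inter> - W)) \<inter> C = {}"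
      using \<open>C \<subseteq> F - {a, b}\<close> clD DR W(2) by blast
    moreover have "closure D \<inter> C \<noteq> {}" using closure_subset[of D] DC by blast
    moreover have "(?R \<union> (?B \<inter> - W)) \<inter> C \<noteq> {}" using CR by blast
    ultimately show False
      using in_components_connected[OF C] closed_closure[of D] unfolding connected_closed by blast
  qed
qed

text \<open>The induction step. Let \<open>B\<close> be the bead containing \<open>a = g a'\<close> and \<open>b = g b'\<close>, and \<open>R\<close> the
  complementary chain, with common nodes \<open>u\<close> and \<open>v\<close>. A component \<open>C\<close> that avoids \<open>R\<close> is the image of a
  component of \<open>F - {a', b'}\<close>. A component that meets \<open>R\<close> contains all of \<open>R - {a, b}\<close>, and is equal to it if
  \<open>a\<close>, \<open>b\<close> are \<open>u\<close> and \<open>v\<close>. Otherwise \<open>R\<close> is an ear attached to the closure of one component \<open>D\<close> of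
  \<open>B - {a, b}\<close>, again the image of a component of \<open>F - {a', b'}\<close>, or to the closures of two such components,
  whose union has no cut points.\<close>
lemma bounded_cutset_inside_bead:
  assumes g: "g = f (index (Suc k))" and ab: "a' \<in> F" "b' \<in> F" "a' \<noteq> b'"
    and IH: "\<And>C. C \<in> components (F - {a', b'}) \<Longrightarrow> bounded_cutset a' b' (closure C)"
    and C: "C \<in> components (F - {g a', g b'})"
  shows "bounded_cutset (g a') (g b') (closure C)"
proof -
  let ?B = "bead (Suc k)" and ?R = "chain (Suc k) (k + n)"
  let ?u = "node k" and ?v = "node (Suc k)"
  define a b where ab_def: "a = g a'" "b = g b'"
  obtain h where h: "homeomorphism UNIV UNIV g h" using homeomorphism_f g by blast
  have inj: "inj g" using homeomorphism_inj[OF h] .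
  have B: "?B = g ` F" by (simp add: bead_def g)
  have abB: "a \<in> ?B" "b \<in> ?B" "a \<noteq> b" using ab inj by (auto simp: ab_def B inj_def)
  have abF: "a \<in> F" "b \<in> F" using abB bead_subset_F by blast+
  have C: "C \<in> components (F - {a, b})" using C by (simp add: ab_def)
  have clC: "closure C = insert a (insert b C)" by (rule F_component(2)[OF abF abB(3) C])
  have Csub: "C \<subseteq> F - {a, b}" "C \<noteq> {}" "connected C"
    using C in_components_subset in_components_nonempty in_components_connected by blast+
  have FB: "F = ?B \<union> ?R" by (rule F_eq_bead_Un_chain)
  have BR: "?B \<inter> ?R = {?u, ?v}" by (rule bead_Int_chain)
  have uv: "?u \<noteq> ?v" using node_neq[of k "Suc k"] n_ge_3 by simp
  have conR: "connected (?R - {a, b})" using connected_complementary_chain_minus[OF abB] .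
  have Bab: "?B - {a, b} = g ` (F - {a', b'})"
    using inj by (auto simp: B ab_def inj_def)
  have comp_B: "\<exists>D'. D' \<in> components (F - {a', b'}) \<and> D = g ` D' \<and> closure D = g ` closure D' \<and>
      cutset (closure D) = g ` cutset (closure D') \<and> finite (cutset (closure D)) \<and>
      card (cutset (closure D)) = card (cutset (closure D')) \<and>
      card (cutset (closure D)) \<le> n - 2"
    if D: "D \<in> components (?B - {a, b})" for D
  proof -
    obtain D' where D': "D' \<in> components (F - {a', b'})" "D = g ` D'"
      using D unfolding Bab components_image[OF h] by blast
    have "closure D = g ` closure D'" using D'(2) homeomorphism_closure_image[OF h] by simp
    moreover from this have "cutset (closure D) = g ` cutset (closure D')"
      using cutset_image[OF h] by simp
    moreover have "card (g ` cutset (closure D')) = card (cutset (closure D'))"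
      using inj by (simp add: card_image inj_on_subset)
    ultimately show ?thesis using D' IH[OF D'(1)] by (auto simp: bounded_cutset_def)
  qed
  have "bounded_cutset a b (closure C)"
  proof (cases "C \<inter> (?R - {a, b}) = {}")
    case True
    then have CB: "C \<subseteq> ?B - {a, b}" using Csub(1) FB by blast
    then have CcompB: "C \<in> components (?B - {a, b})"
      using components_intermediate_subset[OF C CB] bead_subset_F by blast
    then obtain C' where C': "C' \<in> components (F - {a', b'})" "closure C = g ` closure C'"
        "finite (cutset (closure C))" "card (cutset (closure C)) = card (cutset (closure C'))"
        "card (cutset (closure C)) \<le> n - 2"
      using comp_B by blast
    have "\<not> (good \<and> card (cutset (closure C)) = n - 2)"
    proof
      assume g2: "good \<and> card (cutset (closure C)) = n - 2"
      then obtain j where j: "{a', b'} = {node j, node (Suc j)}" "closure C' = chain (Suc j) (j + n)"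
        using IH[OF C'(1)] C'(4) by (auto simp: bounded_cutset_def)
      \<comment> \<open>Equality for the pulled-back pair would make the closure of \<open>C\<close> the image of all beads but one. As \<open>C\<close>
        avoids \<open>u\<close> and \<open>v\<close>, both would lie in the image of the missing bead.\<close>
      have "w \<in> g ` bead (Suc j)" if w: "w \<in> {?u, ?v}" for w
      proof -
        have "w \<in> ?B" "w \<in> ?R" using w BR by blast+
        then have "w \<notin> C" using True Csub(1) by blast
        show ?thesis
        proof (cases "w \<in> closure C")
          case True
          then have "w \<in> {a, b}" using clC \<open>w \<notin> C\<close> by blast
          then have "w \<in> g ` {a', b'}" by (auto simp: ab_def)
          then show ?thesis using j(1) node_in_bead[of "Suc j"] node_in_bead_Suc[of j] by auto
        next
          case False
          then show ?thesis
            using \<open>w \<in> ?B\<close> F_eq_bead_Un_chain[of j] unfolding B C'(2) j(2) by blast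
        qed
      qed
      then show False using g2 unfolding good_def g by blast
    qed
    then show ?thesis using C'(3,5) by (auto simp: bounded_cutset_def)
  next
    case False
    have RC: "?R - {a, b} \<subseteq> C"
      using components_maximal[OF C conR] FB False by blast
    have clC_eq: "closure C = ?R \<union> insert a (insert b (C \<inter> ?B))"
    proof -
      have "C \<subseteq> ?R \<union> (C \<inter> ?B)" using Csub(1) FB by blast
      moreover have "?R \<subseteq> insert a (insert b C)" using RC by blast
      ultimately show ?thesis unfolding clC by blast
    qed
    have ends: "connected (?R - {p}) \<or> (\<exists>S T. ?R - {p} = S \<union> T \<and> connected S \<and> connected T \<and> ?v \<in> S \<and> ?u \<in> T)" for p
      using chain_ends[of "Suc k" "k + n" p] n_ge_3 by simp
    have conR': "connected ?R" using chain_connected n_ge_3 by simp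
    have uvR: "?v \<in> ?R" "?u \<in> ?R" using BR by blast+
    note ear = cutset_ear[OF conR' _ uv[symmetric] uvR _ _ ends]
    note meets = component_in_bead_meets_nodes[OF abB C False]
    show ?thesis
    proof (cases "{a, b} = {?u, ?v}")
      \<comment> \<open>The equality case: \<open>C\<close> is the complementary chain without its end points.\<close>
      case True
      have "F = ?R \<union> ?B" using FB by blast
      then have "C = ?R - {a, b}"
        using BR True by (intro component_of_closed_split[OF C _ _ closed_chain closed_bead conR False]) auto
      moreover have "{a, b} \<subseteq> ?R" unfolding True using uvR by blast
      ultimately have "closure C = ?R" unfolding clC by blast
      then show ?thesis
        using card_cutset_chain[of "Suc k" "k + n"] n_ge_3 True by (auto simp: bounded_cutset_def)
    next
      case ne: False
      define comp where "comp w = connected_component_set (?B - {a, b}) w" for w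
      have comp: "comp w \<in> components (?B - {a, b})" "w \<in> comp w" "comp w \<subseteq> C"
        if w: "w \<in> {?u, ?v} - {a, b}" for w
      proof -
        have "w \<in> ?B - {a, b}" using w BR by blast
        then show "comp w \<in> components (?B - {a, b})" "w \<in> comp w"
          by (auto simp: comp_def componentsI)
        moreover have "w \<in> C" using w RC uvR by blast
        ultimately show "comp w \<subseteq> C" using meets(1) by blast
      qed
      have cover: "\<exists>w\<in>{?u, ?v} - {a, b}. x \<in> comp w" if x: "x \<in> C \<inter> ?B" for x
      proof -
        have "x \<in> ?B - {a, b}" using x Csub by blast
        then have "comp x \<in> components (?B - {a, b})" "x \<in> comp x"
          by (auto simp: comp_def componentsI)
        then obtain w where w: "w \<in> {?u, ?v}" "w \<in> comp x" using meets(2) x by blast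
        moreover have "w \<notin> {a, b}" using w(2) connected_component_subset unfolding comp_def by blast
        moreover have "comp w = comp x" using w(2) unfolding comp_def by (rule connected_component_eq)
        ultimately show ?thesis using \<open>x \<in> comp x\<close> by blast
      qed
      show ?thesis
      proof (cases "?u \<in> {a, b} \<or> ?v \<in> {a, b} \<or> comp ?u = comp ?v")
        case one: True
        have "\<not> {?u, ?v} \<subseteq> {a, b}" using ne uv by auto
        then obtain w where w: "w \<in> {?u, ?v} - {a, b}" by blast
        define D where "D = comp w"
        have D: "D \<in> components (?B - {a, b})" using comp[OF w] by (simp add: D_def)
        have CB: "C \<inter> ?B = D"
        proof
          show "D \<subseteq> C \<inter> ?B" using comp(3)[OF w] in_components_subset[OF D] by (auto simp: D_def)
          have "comp w' = D" if "w' \<in> {?u, ?v} - {a, b}" for w'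
            using one w that unfolding D_def by (elim DiffE insertE emptyE disjE; simp)
          then show "C \<inter> ?B \<subseteq> D" using cover by blast
        qed
        have clD: "closure D = insert a (insert b D)" by (rule bead_component(2)[OF abB D])
        have clC2: "closure C = ?R \<union> closure D" unfolding clC_eq CB clD ..
        have node_D: "x \<in> closure D" if "x \<in> ?B \<inter> ?R" for x
          unfolding clD using that RC CB by blast
        have uvD: "?u \<in> closure D" "?v \<in> closure D"
          using node_D unfolding BR by blast+
        have conD: "connected (closure D)"
          using in_components_connected[OF D] by (rule connected_imp_connected_closure)
        have sub: "cutset (closure C) \<subseteq> cutset (closure D)"
          unfolding clC2 by (rule ear[OF conD uvD(2,1)])
        obtain D' where D': "D' \<in> components (F - {a', b'})" "closure D = g ` closure D'"
            "cutset (closure D) = g ` cutset (closure D')"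
            "finite (cutset (closure D))" "card (cutset (closure D)) = card (cutset (closure D'))"
            "card (cutset (closure D)) \<le> n - 2"
          using comp_B[OF D] by blast
        have fin: "finite (cutset (closure C))" and le: "card (cutset (closure C)) \<le> n - 2"
          using finite_subset[OF sub D'(4)] card_mono[OF D'(4) sub] D'(6) by auto
        have "\<not> (good \<and> card (cutset (closure C)) = n - 2)"
        proof
          assume g2: "good \<and> card (cutset (closure C)) = n - 2"
          \<comment> \<open>Equality makes the closure of \<open>D\<close> the image of a chain. By goodness \<open>u\<close> and \<open>v\<close> lie in different
            beads of it, so one of its cut points separates them and is lost on adding the ear \<open>R\<close>.\<close>
          then have eq: "cutset (closure C) = cutset (closure D)" "card (cutset (closure D)) = n - 2"
            using card_seteq[OF D'(4) sub] D'(6) by auto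
          then obtain j where j: "closure D' = chain (Suc j) (j + n)"
            using IH[OF D'(1)] D'(5) g2 by (auto simp: bounded_cutset_def)
          obtain u' v' where uv': "?u = g u'" "?v = g v'" "u' \<in> chain (Suc j) (j + n)" "v' \<in> chain (Suc j) (j + n)"
            using uvD unfolding D'(2) j by blast
          have "\<not> (u' \<in> bead t \<and> v' \<in> bead t)" for t
            using g2 uv' unfolding good_def g by blast
          then obtain s where s: "Suc j < s" "s < j + n"
            "u' \<in> chain (Suc j) s - {node s} \<and> v' \<in> chain s (j + n) - {node s} \<or>
             v' \<in> chain (Suc j) s - {node s} \<and> u' \<in> chain s (j + n) - {node s}"
            using chain_separates[OF uv'(3,4)] by auto
          let ?p = "g (node s)"
          note A = chain_minus_inner_node[OF s(1,2)]
          have gdiff: "g ` (X - {node s}) = g ` X - {?p}" for X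
            using inj by (auto simp: inj_def)
          have split: "closure D - {?p} = g ` (chain (Suc j) s - {node s}) \<union> g ` (chain s (j + n) - {node s})"
            unfolding D'(2) j gdiff[symmetric] using A(1) by (simp add: image_Un)
          have con: "connected (g ` (chain (Suc j) s - {node s}))" "connected (g ` (chain s (j + n) - {node s}))"
            using A(2,3) homeomorphism_connected_image[OF h] by simp_all
          have "?p \<in> ?B" unfolding B using node_in_bead bead_subset_F by blast
          moreover have "?p \<noteq> ?u" "?p \<noteq> ?v" using s(3) uv' inj by (auto simp: inj_eq)
          ultimately have pR: "?p \<notin> ?R" using BR by blast
          have "?p \<notin> cutset (?R \<union> closure D)"
            using s(3)
          proof
            assume "u' \<in> chain (Suc j) s - {node s} \<and> v' \<in> chain s (j + n) - {node s}"
            then show ?thesis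
              by (intro not_cutset_ear[OF conR' uvR(2,1) pR split con]) (auto simp: uv')
          next
            assume "v' \<in> chain (Suc j) s - {node s} \<and> u' \<in> chain s (j + n) - {node s}"
            then show ?thesis
              by (intro not_cutset_ear[OF conR' uvR(1,2) pR split con]) (auto simp: uv')
          qed
          moreover have "?p \<in> cutset (closure D)"
            unfolding D'(3) j using cutset_chain[of "Suc j" "j + n"] s by auto
          ultimately show False using eq(1) clC2 by simp
        qed
        then show ?thesis using fin le by (auto simp: bounded_cutset_def)
      next
        case two: False
        have u: "?u \<in> {?u, ?v} - {a, b}" and v: "?v \<in> {?u, ?v} - {a, b}" using two by blast+
        let ?D = "comp ?u" and ?E = "comp ?v"
        have DE: "?D \<in> components (?B - {a, b})" "?E \<in> components (?B - {a, b})" "?D \<noteq> ?E"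
          using comp(1) u v two by blast+
        have CB: "C \<inter> ?B = ?D \<union> ?E"
        proof
          show "C \<inter> ?B \<subseteq> ?D \<union> ?E" using cover by blast
          show "?D \<union> ?E \<subseteq> C \<inter> ?B"
            using comp(3) u v in_components_subset[OF DE(1)] in_components_subset[OF DE(2)] by blast
        qed
        have clD: "closure ?D = insert a (insert b ?D)" and clE: "closure ?E = insert a (insert b ?E)"
          using bead_component(2)[OF abB] DE by auto
        have clC2: "closure C = ?R \<union> (closure ?D \<union> closure ?E)"
          unfolding clC_eq CB clD clE by blast
        have "connected (closure ?D \<union> closure ?E)"
        proof (rule connected_Un)
          show "connected (closure ?D)" "connected (closure ?E)"
            using DE in_components_connected connected_imp_connected_closure by blast+
        qed (use clD clE in blast)
        then have "cutset (closure C) \<subseteq> cutset (closure ?D \<union> closure ?E)"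
          unfolding clC2
          by (rule ear) (use comp(2) u v closure_subset in blast)+
        also have "\<dots> = {}"
          by (rule cutset_two_components[OF closed_bead locally_connected_bead connected_bead_minus abB DE])
        finally have "cutset (closure C) = {}" by blast
        then show ?thesis using n_ge_3 by (intro bounded_cutsetI) simp_all
      qed
    qed
  qed
  then show ?thesis by (simp add: ab_def)
qed

text \<open>Pulling \<open>a\<close> and \<open>b\<close> back through a common bead multiplies their distance by at least \<open>1 / c\<close>.
  As \<open>F\<close> is bounded, this stops after finitely many steps at a pair without a common bead.\<close>
lemma bounded_cutset_component:
  assumes "a \<in> F" "b \<in> F" "a \<noteq> b" "C \<in> components (F - {a, b})"
  shows "bounded_cutset a b (closure C)"
proof -
  obtain c where c: "0 < c" "c < 1" "\<And>i x y. dist (f (index i) x) (f (index i) y) \<le> c * dist x y"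
    by (rule contraction) blast
  obtain D where D: "\<And>x y. x \<in> F \<Longrightarrow> y \<in> F \<Longrightarrow> dist x y \<le> D" "0 < D"
    by (rule bounded_F) blast
  have step: "bounded_cutset a b (closure C)"
    if "a \<in> F" "b \<in> F" "a \<noteq> b" "C \<in> components (F - {a, b})" "c ^ m * D < dist a b" for m a b C
    using that
  proof (induction m arbitrary: a b C)
    case 0
    then show ?case using D(1)[of a b] by simp
  next
    case (Suc m)
    show ?case
    proof (cases "\<exists>k. {a, b} \<subseteq> bead (Suc k)")
      case True
      then obtain k a' b' where k: "a' \<in> F" "b' \<in> F" "a = f (index (Suc k)) a'" "b = f (index (Suc k)) b'"
        unfolding bead_def by blast
      have "a' \<noteq> b'" using k Suc.prems(3) by blast
      have "c * (c ^ m * D) < c * dist a' b'"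
        using Suc.prems(5) c(3)[of "Suc k" a' b'] by (simp add: k mult.assoc)
      then have "c ^ m * D < dist a' b'" using c(1) by simp
      then have "bounded_cutset a' b' (closure E)" if "E \<in> components (F - {a', b'})" for E
        using Suc.IH[OF k(1,2) \<open>a' \<noteq> b'\<close> that] by blast
      then show ?thesis
        unfolding k(3,4)
        by (rule bounded_cutset_inside_bead[OF refl k(1,2) \<open>a' \<noteq> b'\<close>])
          (use Suc.prems(4) k(3,4) in simp_all)
    next
      case False
      have "\<not> {a, b} \<subseteq> bead t" for t
      proof -
        have "bead t = bead (Suc (t + n - 1))" using n_ge_3 by simp
        then show ?thesis using False by metis
      qed
      then show ?thesis using bounded_cutset_no_common_bead Suc.prems by blast
    qed
  qed
  have "(\<lambda>m. c ^ m * D) \<longlonglongrightarrow> 0"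
    using c by (intro tendsto_mult_left_zero LIMSEQ_power_zero) auto
  moreover have "0 < dist a b" using assms(3) by simp
  ultimately obtain m where "c ^ m * D < dist a b"
    using order_tendstoD(2) eventually_sequentially by (metis (no_types, lifting) order_refl)
  then show ?thesis using step assms by blast
qed

section \<open>Extremal 2-cuts\<close>

lemma node_in_F: "node i \<in> F"
  using node_in_bead bead_subset_F by blast

lemma adjacent_nodes:
  "node k \<noteq> node (Suc k)"
  "node k \<in> chain (Suc k) (k + n)" "node (Suc k) \<in> chain (Suc k) (k + n)"
  using node_neq[of k "Suc k"] n_ge_3 bead_Int_chain[of k] by auto

lemma infinite_connected:
  assumes "connected S" "x \<in> S" "y \<in> S" "x \<noteq> y"
  shows "infinite (S :: 'a set)"
  using assms connected_finite_iff_sing by blast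

text \<open>Bead \<open>k + 1\<close> and the complementary chain are closed and meet exactly in the two removed nodes.\<close>
lemma adjacent_nodes_separate:
  shows "chain (Suc k) (k + n) - {node k, node (Suc k)} \<in> components (F - {node k, node (Suc k)})"
    and "\<not> connected (F - {node k, node (Suc k)})"
proof -
  let ?B = "bead (Suc k)" and ?R = "chain (Suc k) (k + n)" and ?A = "{node k, node (Suc k)}"
  have F: "F = ?R \<union> ?B" using F_eq_bead_Un_chain[of k] by blast
  have RB: "?R \<inter> ?B = ?A" using bead_Int_chain[of k] by blast
  have A: "node k \<in> ?B" "node (Suc k) \<in> ?B" "node k \<noteq> node (Suc k)"
    using RB adjacent_nodes[of k] by blast+
  have conR: "connected ?R" using chain_connected n_ge_3 by simp
  have "infinite (?R - ?A)" "infinite (?B - ?A)"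
    using infinite_connected[OF conR adjacent_nodes(2,3,1)] infinite_connected[OF connected_bead A]
    by simp_all
  then have ne: "?R - ?A \<noteq> {}" "?B - ?A \<noteq> {}" by (metis finite.emptyI)+
  have con: "connected (?R - ?A)" by (rule connected_complementary_chain_minus[OF A])
  obtain x where x: "x \<in> ?R - ?A" using ne(1) by blast
  define C where "C = connected_component_set (F - ?A) x"
  have C: "C \<in> components (F - ?A)" "x \<in> C"
  proof -
    have "x \<in> F - ?A" using x F by blast
    then show "C \<in> components (F - ?A)" "x \<in> C" unfolding C_def by (auto intro: componentsI)
  qed
  have "C = ?R - ?A"
    using RB x C(2) by (intro component_of_closed_split[OF C(1) F _ closed_chain closed_bead con]) auto
  then show "?R - ?A \<in> components (F - ?A)" using C(1) by simp
  show "\<not> connected (F - ?A)"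
    unfolding connected_closed
  proof (intro notI, elim notE, intro exI conjI)
    show "closed ?R" "closed ?B" by (rule closed_chain closed_bead)+
    show "F - ?A \<subseteq> ?R \<union> ?B" using F by blast
    show "?R \<inter> ?B \<inter> (F - ?A) = {}" using RB by blast
    show "?R \<inter> (F - ?A) \<noteq> {}" "?B \<inter> (F - ?A) \<noteq> {}" using ne F by blast+
  qed
qed

text \<open>Each of the two nodes is a limit of points of the complementary chain, a connected set with more
  than one point.\<close>
lemma adjacent_nodes_frontier:
  "{node k, node (Suc k)} \<subseteq> top_of_set F frontier_of bead (Suc k)"
proof
  let ?B = "bead (Suc k)" and ?R = "chain (Suc k) (k + n)" and ?A = "{node k, node (Suc k)}"
  fix w assume w: "w \<in> ?A"
  have "connected ?R" using chain_connected n_ge_3 by simp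
  then have "w islimpt ?R"
    using w adjacent_nodes[of k] by (intro connected_imp_perfect) auto
  then have "w islimpt (?A \<union> (?R - ?A))"
    by (rule islimpt_subset) blast
  then have "w islimpt (?R - ?A)"
    by (rule iffD1[OF islimpt_Un_finite, rotated]) simp
  moreover have "?R - ?A \<subseteq> F - ?B" using bead_Int_chain[of k] chain_subset_F by blast
  ultimately have "w islimpt (F - ?B)" by (rule islimpt_subset)
  then have "w \<in> closure (F - ?B)" by (simp add: closure_def)
  moreover have "w \<in> closure ?B" using w bead_Int_chain[of k] closure_subset by blast
  moreover have "w \<in> F" using w node_in_F by blast
  ultimately show "w \<in> top_of_set F frontier_of ?B"
    using bead_subset_F[of "Suc k"]
    by (simp add: frontier_of_closures closure_of_subtopology Int_absorb1 Diff_subset)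
qed

lemma good_necklace_imp_good: "good_necklace n f F \<Longrightarrow> good"
  unfolding good_def
proof (intro allI notI)
  fix k j
  assume gn: "good_necklace n f F" and sub: "{node k, node (Suc k)} \<subseteq> f (index (Suc k)) ` bead j"
  let ?S = "(f (index (Suc k)) \<circ> f (index j)) ` F \<inter> (top_of_set F frontier_of bead (Suc k))"
  have "{node k, node (Suc k)} \<subseteq> ?S"
    using sub adjacent_nodes_frontier[of k] by (simp add: bead_def image_comp)
  moreover have "ecard ?S \<le> 1"
    using gn index_range[of "Suc k"] index_range[of j] unfolding good_necklace_def bead_def by blast
  then have "finite ?S" "card ?S \<le> 1"
    by (auto simp: ecard_def one_enat_def split: if_splits)
  ultimately have "card {node k, node (Suc k)} \<le> 1" by (meson card_mono le_trans)
  then show False using adjacent_nodes(1)[of k] by simp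
qed

lemma cut_N_pair:
  "a \<in> F \<Longrightarrow> b \<in> F \<Longrightarrow>
    cut_N {a, b} (top_of_set F) = (SUP C \<in> components (F - {a, b}). ecard (cutset (closure C)))"
  by (rule cut_N_top_of_set) (auto simp: compact_imp_closed[OF compact_F])

lemma cut_N_pair_le:
  assumes "a \<in> F" "b \<in> F" "a \<noteq> b"
  shows "cut_N {a, b} (top_of_set F) \<le> enat (n - 2)"
  unfolding cut_N_pair[OF assms(1,2)]
  using bounded_cutset_component[OF assms] by (intro SUP_least) (auto simp: bounded_cutset_def ecard_def)

lemma cut_N_pair_less:
  assumes "a \<in> F" "b \<in> F" "a \<noteq> b" good "\<And>k. {a, b} \<noteq> {node k, node (Suc k)}"
  shows "cut_N {a, b} (top_of_set F) < enat (n - 2)"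
proof -
  have "ecard (cutset (closure C)) \<le> enat (n - 3)" if "C \<in> components (F - {a, b})" for C
  proof -
    have "finite (cutset (closure C))" "card (cutset (closure C)) \<le> n - 2" "card (cutset (closure C)) \<noteq> n - 2"
      using bounded_cutset_component[OF assms(1-3) that] assms(4,5) by (auto simp: bounded_cutset_def)
    then show ?thesis by (auto simp: ecard_def)
  qed
  then have "cut_N {a, b} (top_of_set F) \<le> enat (n - 3)"
    unfolding cut_N_pair[OF assms(1,2)] by (rule SUP_least)
  also have "\<dots> < enat (n - 2)" using n_ge_3 by simp
  finally show ?thesis .
qed

lemma cut_N_adjacent_nodes:
  "cut_N {node k, node (Suc k)} (top_of_set F) = enat (n - 2)"
proof (rule antisym)
  let ?R = "chain (Suc k) (k + n)" and ?A = "{node k, node (Suc k)}"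
  show "cut_N ?A (top_of_set F) \<le> enat (n - 2)"
    by (rule cut_N_pair_le[OF node_in_F node_in_F adjacent_nodes(1)])
  have cl: "closure (?R - ?A) = insert (node k) (insert (node (Suc k)) (?R - ?A))"
    by (rule F_component(2)[OF node_in_F node_in_F adjacent_nodes(1) adjacent_nodes_separate(1)])
  have "closure (?R - ?A) = ?R"
    unfolding cl using adjacent_nodes(2,3)[of k] by blast
  then have "ecard (cutset (closure (?R - ?A))) = enat (n - 2)"
    using card_cutset_chain[of "Suc k" "k + n"] n_ge_3 by (simp add: ecard_def)
  then show "enat (n - 2) \<le> cut_N ?A (top_of_set F)"
    unfolding cut_N_pair[OF node_in_F node_in_F]
    using SUP_upper[OF adjacent_nodes_separate(1), of "\<lambda>C. ecard (cutset (closure C))"] by metis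
qed

lemma two_cut_iff:
  "is_k_cut 2 (top_of_set F) A \<longleftrightarrow>
    (\<exists>a b. A = {a, b} \<and> a \<noteq> b \<and> a \<in> F \<and> b \<in> F \<and> \<not> connected (F - A))"
  by (rule is_2_cut_top_of_set[OF connected_F cutset_F])

lemma two_cut_adjacent_nodes: "is_k_cut 2 (top_of_set F) {node k, node (Suc k)}"
  unfolding two_cut_iff using adjacent_nodes(1) node_in_F adjacent_nodes_separate(2) by blast

lemma cut_N_2: "cut_N_k 2 (top_of_set F) = enat (n - 2)"
proof (rule antisym)
  show "cut_N_k 2 (top_of_set F) \<le> enat (n - 2)"
    unfolding cut_N_k_def by (rule SUP_least) (auto simp: two_cut_iff cut_N_pair_le)
  have "cut_N {node 0, node (Suc 0)} (top_of_set F) \<le> cut_N_k 2 (top_of_set F)"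
    unfolding cut_N_k_def using two_cut_adjacent_nodes by (intro SUP_upper) blast
  then show "enat (n - 2) \<le> cut_N_k 2 (top_of_set F)" by (simp only: cut_N_adjacent_nodes)
qed

lemma extremal_adjacent_nodes: "extremal_k_cut 2 (top_of_set F) {node k, node (Suc k)}"
  by (simp add: extremal_k_cut_def two_cut_adjacent_nodes cut_N_adjacent_nodes cut_N_2)

lemma extremal_imp_adjacent_nodes:
  assumes "extremal_k_cut 2 (top_of_set F) A" good
  shows "\<exists>k. A = {node k, node (Suc k)}"
proof (rule ccontr)
  assume no: "\<not> ?thesis"
  obtain a b where ab: "A = {a, b}" "a \<noteq> b" "a \<in> F" "b \<in> F"
    using assms(1) by (auto simp: extremal_k_cut_def two_cut_iff)
  have "cut_N A (top_of_set F) < enat (n - 2)"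
    unfolding ab(1) by (rule cut_N_pair_less[OF ab(3,4,2) assms(2)]) (use no ab(1) in blast)
  then show False using assms(1) by (simp add: extremal_k_cut_def cut_N_2)
qed

lemma adjacent_nodes_eq_z:
  "{{node k, node (Suc k)} | k. True} = {{z (k - 1), z k} | k. k \<in> {1..n}}"
proof (intro subset_antisym subsetI)
  fix A assume "A \<in> {{node k, node (Suc k)} | k. True}"
  then obtain k where A: "A = {node k, node (Suc k)}" by blast
  have "k mod n < n" using n_ge_3 by simp
  moreover have "node k = node (k mod n)" "node (Suc k) = node (Suc (k mod n))"
    by (simp_all add: node_eq_iff mod_Suc_eq)
  ultimately have "A = {z (Suc (k mod n) - 1), z (Suc (k mod n))}" "Suc (k mod n) \<in> {1..n}"
    using node_eq_z A by auto
  then show "A \<in> {{z (k - 1), z k} | k. k \<in> {1..n}}" by blast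
next
  fix A assume "A \<in> {{z (k - 1), z k} | k. k \<in> {1..n}}"
  then obtain k where "A = {z (k - 1), z k}" "k \<in> {1..n}" by blast
  then have "A = {node (k - 1), node (Suc (k - 1))}" using node_eq_z by auto
  then show "A \<in> {{node k, node (Suc k)} | k. True}" by blast
qed

end

theorem theorem2p1:
  fixes f :: "nat \<Rightarrow> real ^ 'd \<Rightarrow> real ^ 'd"
    and F :: "(real ^ 'd) set"
    and z :: "nat \<Rightarrow> real ^ 'd"
    and n :: nat
  assumes "is_NIFS n f F"
    and "main_nodes n f F z"
    and "cut_points (top_of_set F) = {}"
  shows "cut_N_k 2 (top_of_set F) = enat (n - 2) \<and>
    (\<forall>k\<in>{1..n}. extremal_k_cut 2 (top_of_set F) {z (k - 1), z k}) \<and>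
    (good_necklace n f F \<longrightarrow>
       {A. extremal_k_cut 2 (top_of_set F) A} = {{z (k - 1), z k} | k. k \<in> {1..n}})"
proof -
  interpret necklace n f F z using assms by unfold_locales
  have extremal: "extremal_k_cut 2 (top_of_set F) A" if "A \<in> {{z (k - 1), z k} | k. k \<in> {1..n}}" for A
    using that extremal_adjacent_nodes unfolding adjacent_nodes_eq_z[symmetric] by blast
  show ?thesis
  proof (intro conjI ballI impI)
    show "cut_N_k 2 (top_of_set F) = enat (n - 2)" by (rule cut_N_2)
    show "extremal_k_cut 2 (top_of_set F) {z (k - 1), z k}" if "k \<in> {1..n}" for k
      using extremal that by blast
    assume "good_necklace n f F"
    then have "A \<in> {{z (k - 1), z k} | k. k \<in> {1..n}}" if "extremal_k_cut 2 (top_of_set F) A" for A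
      using extremal_imp_adjacent_nodes[OF that good_necklace_imp_good]
      unfolding adjacent_nodes_eq_z[symmetric] by blast
    then show "{A. extremal_k_cut 2 (top_of_set F) A} = {{z (k - 1), z k} | k. k \<in> {1..n}}"
      using extremal by blast
  qed
qed

end
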